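(* Let $a<b$ be real numbers, $\alpha,\beta\in(0,1)$, and let $L\in C^1([a,b]\times\mathbb{R}^2;\mathbb{R})$. Consider the problem of minimizing $$\mathcal{J}(y)=\int_a^b L\bigl(x,\,{}_aI_x^{1-\alpha}y(x),\,{}_aD_x^{\beta}y(x)\bigr)\,dx$$ over admissible functions $y:[a,b]\to\mathbb{R}$, under the following regularity assumptions: the function $x\mapsto \partial_2L(x,{}_aI_x^{1-\alpha}y(x),{}_aD_x^{\beta}y(x))$ has a continuous right Riemann-Liouville fractional integral of order $1-\alpha$, and the function $x\mapsto \partial_3L(x,{}_aI_x^{1-\alpha}y(x),{}_aD_x^{\beta}y(x))$ has a continuous right Riemann-Liouville fractional derivative of order $\beta$. If $y$ is a local minimizer of this problem, then $${}_xI_b^{1-\alpha}\,\partial_2L\bigl(x,{}_aI_x^{1-\alpha}y(x),{}_aD_x^{\beta}y(x)\bigr)+{}_xD_b^{\beta}\,\partial_3L\bigl(x,{}_aI_x^{1-\alpha}y(x),{}_aD_x^{\beta}y(x)\bigr)=0$$ for all $x\in[a,b]$.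
   Context: Fractional operators. For $\gamma\in(0,1)$ and $f$ defined on $[a,b]$: left Riemann-Liouville fractional integral ${}_aI_x^{\gamma}f(x)=\frac{1}{\Gamma(\gamma)}\int_a^x (x-t)^{\gamma-1}f(t)\,dt$; right Riemann-Liouville fractional integral ${}_xI_b^{\gamma}f(x)=\frac{1}{\Gamma(\gamma)}\int_x^b (t-x)^{\gamma-1}f(t)\,dt$; left Riemann-Liouville fractional derivative ${}_aD_x^{\gamma}f(x)=\frac{d}{dx}\,{}_aI_x^{1-\gamma}f(x)$; right Riemann-Liouville fractional derivative ${}_xD_b^{\gamma}f(x)=-\frac{d}{dx}\,{}_xI_b^{1-\gamma}f(x)$. $\partial_kL$ denotes the partial derivative of $L$ with respect to its $k$-th argument. In the conclusion, the right operators are applied to the functions of $x$ obtained by composing $\partial_2L$, $\partial_3L$ with $x\mapsto(x,{}_aI_x^{1-\alpha}y(x),{}_aD_x^{\beta}y(x))$. Admissible functions are functions $y:[a,b]\to\mathbb{R}$ such that ${}_aI_x^{1-\alpha}y(x)$ and ${}_aD_x^{\beta}y(x)$ exist on the closed interval $[a,b]$ (and for which $\mathcal{J}(y)$ is defined). An admissible $y$ is a local minimizer if for every variation $\eta$ such that $y+\epsilon\eta$ is admissible for all sufficiently small $|\epsilon|$, the function $\epsilon\mapsto\mathcal{J}(y+\epsilon\eta)$ has a local minimum at $\epsilon=0$.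
   Formalization: It is additionally assumed that the left fractional derivative of order β of the minimizer y is bounded on [a,b]; with mere pointwise existence on [a,b] the Euler–Lagrange equation can fail. *)

theory Defs
  imports "HOL-Analysis.Analysis"
begin

text \<open>
  Functions on \<open>[a,b]\<close> are represented by total functions on the reals; every notion
  below depends only on their values on \<open>[a,b]\<close>.  Integrals are Lebesgue integrals.
\<close>

definition left_RL_integral :: "real \<Rightarrow> real \<Rightarrow> (real \<Rightarrow> real) \<Rightarrow> real \<Rightarrow> real" where
  "left_RL_integral a \<gamma> f x =
     1 / Gamma \<gamma> * (LINT t:{a..x}|lebesgue. (x - t) powr (\<gamma> - 1) * f t)"

definition right_RL_integral :: "real \<Rightarrow> real \<Rightarrow> (real \<Rightarrow> real) \<Rightarrow> real \<Rightarrow> real" where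
  "right_RL_integral b \<gamma> f x =
     1 / Gamma \<gamma> * (LINT t:{x..b}|lebesgue. (t - x) powr (\<gamma> - 1) * f t)"

definition left_RL_integral_exists :: "real \<Rightarrow> real \<Rightarrow> real \<Rightarrow> (real \<Rightarrow> real) \<Rightarrow> bool" where
  "left_RL_integral_exists a b \<gamma> f \<longleftrightarrow>
     (\<forall>x\<in>{a..b}. (\<lambda>t. (x - t) powr (\<gamma> - 1) * f t) absolutely_integrable_on {a..x})"

definition right_RL_integral_exists :: "real \<Rightarrow> real \<Rightarrow> real \<Rightarrow> (real \<Rightarrow> real) \<Rightarrow> bool" where
  "right_RL_integral_exists a b \<gamma> f \<longleftrightarrow>
     (\<forall>x\<in>{a..b}. (\<lambda>t. (t - x) powr (\<gamma> - 1) * f t) absolutely_integrable_on {x..b})"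

text \<open>
  Derivatives are taken within \<open>[a,b]\<close>, hence are one-sided at the two end points.
\<close>

definition left_RL_deriv :: "real \<Rightarrow> real \<Rightarrow> real \<Rightarrow> (real \<Rightarrow> real) \<Rightarrow> real \<Rightarrow> real" where
  "left_RL_deriv a b \<gamma> f x =
     vector_derivative (left_RL_integral a (1 - \<gamma>) f) (at x within {a..b})"

definition right_RL_deriv :: "real \<Rightarrow> real \<Rightarrow> real \<Rightarrow> (real \<Rightarrow> real) \<Rightarrow> real \<Rightarrow> real" where
  "right_RL_deriv a b \<gamma> f x =
     - vector_derivative (right_RL_integral b (1 - \<gamma>) f) (at x within {a..b})"

definition left_RL_deriv_exists :: "real \<Rightarrow> real \<Rightarrow> real \<Rightarrow> (real \<Rightarrow> real) \<Rightarrow> bool" where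
  "left_RL_deriv_exists a b \<gamma> f \<longleftrightarrow>
     left_RL_integral_exists a b (1 - \<gamma>) f \<and>
     (\<forall>x\<in>{a..b}. left_RL_integral a (1 - \<gamma>) f differentiable (at x within {a..b}))"

definition right_RL_deriv_exists :: "real \<Rightarrow> real \<Rightarrow> real \<Rightarrow> (real \<Rightarrow> real) \<Rightarrow> bool" where
  "right_RL_deriv_exists a b \<gamma> f \<longleftrightarrow>
     right_RL_integral_exists a b (1 - \<gamma>) f \<and>
     (\<forall>x\<in>{a..b}. right_RL_integral b (1 - \<gamma>) f differentiable (at x within {a..b}))"

definition C1_on :: "'a::real_normed_vector set \<Rightarrow> ('a \<Rightarrow> 'b::real_normed_vector) \<Rightarrow> bool" where
  "C1_on S f \<longleftrightarrow>
     (\<exists>f' :: 'a \<Rightarrow> 'a \<Rightarrow>\<^sub>L 'b.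
        (\<forall>z\<in>S. (f has_derivative blinfun_apply (f' z)) (at z within S)) \<and>
        continuous_on S f')"

definition partial2 :: "(real \<times> real \<times> real \<Rightarrow> real) \<Rightarrow> real \<times> real \<times> real \<Rightarrow> real" where
  "partial2 L = (\<lambda>(x, p, v). deriv (\<lambda>s. L (x, s, v)) p)"

definition partial3 :: "(real \<times> real \<times> real \<Rightarrow> real) \<Rightarrow> real \<times> real \<times> real \<Rightarrow> real" where
  "partial3 L = (\<lambda>(x, p, v). deriv (\<lambda>s. L (x, p, s)) v)"

definition frac_arg ::
    "real \<Rightarrow> real \<Rightarrow> real \<Rightarrow> real \<Rightarrow> (real \<Rightarrow> real) \<Rightarrow> real \<Rightarrow> real \<times> real \<times> real" where
  "frac_arg a b \<alpha> \<beta> y x = (x, left_RL_integral a (1 - \<alpha>) y x, left_RL_deriv a b \<beta> y x)"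

definition frac_functional ::
    "real \<Rightarrow> real \<Rightarrow> real \<Rightarrow> real \<Rightarrow> (real \<times> real \<times> real \<Rightarrow> real) \<Rightarrow> (real \<Rightarrow> real) \<Rightarrow> real" where
  "frac_functional a b \<alpha> \<beta> L y = (LINT x:{a..b}|lebesgue. L (frac_arg a b \<alpha> \<beta> y x))"

definition admissible ::
    "real \<Rightarrow> real \<Rightarrow> real \<Rightarrow> real \<Rightarrow> (real \<times> real \<times> real \<Rightarrow> real) \<Rightarrow> (real \<Rightarrow> real) \<Rightarrow> bool" where
  "admissible a b \<alpha> \<beta> L y \<longleftrightarrow>
     left_RL_integral_exists a b (1 - \<alpha>) y \<and>
     left_RL_deriv_exists a b \<beta> y \<and>
     (\<lambda>x. L (frac_arg a b \<alpha> \<beta> y x)) absolutely_integrable_on {a..b}"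

definition local_minimizer ::
    "real \<Rightarrow> real \<Rightarrow> real \<Rightarrow> real \<Rightarrow> (real \<times> real \<times> real \<Rightarrow> real) \<Rightarrow> (real \<Rightarrow> real) \<Rightarrow> bool" where
  "local_minimizer a b \<alpha> \<beta> L y \<longleftrightarrow>
     admissible a b \<alpha> \<beta> L y \<and>
     (\<forall>\<eta>. (\<forall>\<^sub>F \<epsilon> in nhds 0. admissible a b \<alpha> \<beta> L (\<lambda>x. y x + \<epsilon> * \<eta> x)) \<longrightarrow>
          (\<forall>\<^sub>F \<epsilon> in nhds 0. frac_functional a b \<alpha> \<beta> L y
                            \<le> frac_functional a b \<alpha> \<beta> L (\<lambda>x. y x + \<epsilon> * \<eta> x)))"

end

theory Submission
  imports Defs
begin

text \<open>
  Write \<open>P\<close> for the left fractional integral of order \<open>1 - \<alpha>\<close> of \<open>y\<close>, \<open>V\<close> for its left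
  derivative of order \<open>\<beta>\<close>, and \<open>\<phi>\<close>, \<open>\<psi>\<close> for \<open>\<partial>\<^sub>2L\<close>, \<open>\<partial>\<^sub>3L\<close> along \<open>(x, P x, V x)\<close>.
  Every variation used is a fractional integral \<open>\<eta> = I\<^sup>\<beta> v\<close> with \<open>v\<close> continuous: its left derivative
  of order \<open>\<beta>\<close> is \<open>v\<close> at every point of \<open>[a,b]\<close>, so \<open>y + \<epsilon> \<eta>\<close> is admissible for all \<open>\<epsilon>\<close>.
  Differentiating the functional under the integral sign at \<open>\<epsilon> = 0\<close>, for \<open>v\<close> and for \<open>- v\<close>, gives
  \<open>\<integral> \<phi> I\<^sup>1\<^sup>-\<^sup>\<alpha> \<eta> + \<psi> v = 0\<close> for all continuous \<open>v\<close>.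

  Three facts turn this into the Euler-Lagrange equation. All of them come from Fubini's theorem and
  from the identity \<open>I\<^sup>\<beta> I\<^sup>1\<^sup>-\<^sup>\<beta> = I\<^sup>1\<close>, which is the Beta integral
  \<open>\<integral>\<^sub>t\<^sup>x (x - s)\<^sup>\<beta>\<^sup>-\<^sup>1 (s - t)\<^sup>-\<^sup>\<beta> ds = \<Gamma>(\<beta>) \<Gamma>(1 - \<beta>)\<close> (lemma \<open>rl_kernel_convolution\<close>).

  \<^item> Abel inversion (\<open>abel_inversion\<close>): an integrable function whose fractional integral of order \<open>1 - \<beta>\<close> is the
    primitive of a bounded function \<open>g\<close> equals \<open>I\<^sup>\<beta> g\<close> almost everywhere. For \<open>y\<close>, with \<open>g = V\<close>,
    this shows that \<open>y\<close> is essentially bounded, hence that \<open>P\<close> is bounded; the arguments of \<open>L\<close> then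
    stay in a compact set and dominated convergence applies (\<open>first_variation_nonneg\<close>).
    For \<open>\<psi>\<close>, with \<open>D\<close> its right derivative of order \<open>\<beta>\<close>, the right-sided version gives
    \<open>\<psi> = I\<^sub>b\<^sup>\<beta> D\<close> almost everywhere.

  \<^item> Adjointness (\<open>kernel_integral_adjoint\<close>): left and right fractional integrals are adjoint, so with
    \<open>A = I\<^sub>b\<^sup>1\<^sup>-\<^sup>\<alpha> \<phi>\<close> the first variation is \<open>\<integral> w v\<close>, where \<open>w = I\<^sub>b\<^sup>\<beta> (A + D)\<close>.

  \<^item> Since \<open>\<integral> w v = 0\<close> for all continuous \<open>v\<close>, \<open>w\<close> vanishes almost everywhere. Applying
    \<open>I\<^sub>b\<^sup>1\<^sup>-\<^sup>\<beta>\<close> to \<open>w\<close> shows that the integrals of \<open>A + D\<close> over all \<open>[x,b]\<close> are zero, so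
    the continuous function \<open>A + D\<close>, the left-hand side of the equation, is zero.

  The left and right operators are treated together, as integral operators over the fixed interval
  \<open>[a,b]\<close> whose kernels vanish on one side of the diagonal.
\<close>

section \<open>The Riemann-Liouville kernel\<close>

text \<open>
  Cutting the kernel off at \<open>s \<le> 0\<close> lets both one-sided fractional integrals be written as
  integrals over the whole of \<open>[a,b]\<close>, which makes Fubini's theorem directly applicable.
\<close>

definition rl_kernel :: "real \<Rightarrow> real \<Rightarrow> real" where
  "rl_kernel \<gamma> s = (if 0 < s then s powr (\<gamma> - 1) / Gamma \<gamma> else 0)"

lemma rl_kernel_nonneg: "0 < \<gamma> \<Longrightarrow> 0 \<le> rl_kernel \<gamma> s"
  by (auto simp: rl_kernel_def intro!: divide_nonneg_nonneg less_imp_le[OF Gamma_real_pos])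

lemma rl_kernel_measurable [measurable]: "rl_kernel \<gamma> \<in> borel_measurable borel"
  unfolding rl_kernel_def by measurable

text \<open>
  The substitution \<open>u = (s - t) / (x - t)\<close> turns the integral into the Beta integral
  \<open>B(1 - \<gamma>, \<gamma>) = \<Gamma>(1 - \<gamma>) \<Gamma>(\<gamma>)\<close>; the powers of \<open>x - t\<close> cancel because the two orders add up to one.
\<close>

lemma rl_kernel_has_integral_mult:
  assumes \<gamma>: "0 < \<gamma>" "\<gamma> < 1" and tx: "t < x"
  shows "((\<lambda>s. rl_kernel \<gamma> (x - s) * rl_kernel (1 - \<gamma>) (s - t)) has_integral 1) {t..x}"
proof -
  define m where "m = 1 / (x - t)"
  have m: "m > 0" using tx by (simp add: m_def)
  let ?F = "\<lambda>u::real. u powr ((1 - \<gamma>) - 1) * (1 - u) powr (\<gamma> - 1)"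
  have beta: "(?F has_integral Beta (1 - \<gamma>) \<gamma>) (cbox 0 1)"
    using has_integral_Beta_real[of "1 - \<gamma>" \<gamma>] \<gamma> by simp
  have e: "(0 - (- m * t)) /\<^sub>R m = t" "(1 - (- m * t)) /\<^sub>R m = x"
    using m tx by (auto simp: m_def field_simps)
  have 1: "((\<lambda>s. ?F (m * s + - m * t)) has_integral (Beta (1 - \<gamma>) \<gamma> / m)) {t..x}"
    using has_integral_affinity'[OF beta m, of "- m * t"] unfolding e by (simp add: field_simps)
  have B: "Beta (1 - \<gamma>) \<gamma> = Gamma (1 - \<gamma>) * Gamma \<gamma>"
    by (simp add: Beta_def)
  have g: "Gamma (1 - \<gamma>) > 0" "Gamma \<gamma> > 0" using \<gamma> by (auto intro: Gamma_real_pos)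
  have 2: "((\<lambda>s. (m / (Gamma (1 - \<gamma>) * Gamma \<gamma>)) * ?F (m * s + - m * t)) has_integral
      (m / (Gamma (1 - \<gamma>) * Gamma \<gamma>)) * (Beta (1 - \<gamma>) \<gamma> / m)) {t..x}"
    by (rule has_integral_mult_right[OF 1])
  have 3: "(m / (Gamma (1 - \<gamma>) * Gamma \<gamma>)) * (Beta (1 - \<gamma>) \<gamma> / m) = 1"
    unfolding B using g m by simp
  show ?thesis
  proof (rule has_integral_spike_finite[OF _ _ 2[unfolded 3], of "{t, x}"])
    fix s assume s: "s \<in> {t..x} - {t, x}"
    then have p: "0 < s - t" "0 < x - s" by auto
    have u1: "m * s + - m * t = m * (s - t)" by (simp add: algebra_simps)
    have "1 = m * (x - t)" using tx by (simp add: m_def)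
    then have u2: "1 - (m * s + - m * t) = m * (x - s)" by (simp add: algebra_simps)
    have "m powr (- \<gamma>) * m powr (\<gamma> - 1) = m powr (-1)"
      by (simp add: powr_add[symmetric])
    also have "\<dots> = inverse m" using m by (simp add: powr_minus)
    finally have "m * (m powr (- \<gamma>) * m powr (\<gamma> - 1)) = 1" using m by simp
    then have "m * ?F (m * s + - m * t) = (s - t) powr (- \<gamma>) * (x - s) powr (\<gamma> - 1)"
      unfolding u2 unfolding u1 using m p
      by (simp add: powr_mult mult.assoc mult.left_commute)
    then show "rl_kernel \<gamma> (x - s) * rl_kernel (1 - \<gamma>) (s - t) =
      (m / (Gamma (1 - \<gamma>) * Gamma \<gamma>)) * ?F (m * s + - m * t)"
      using p g by (simp add: rl_kernel_def field_simps)
  qed auto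
qed

text \<open>
  The kernel form of \<open>I\<^sup>\<gamma> I\<^sup>1\<^sup>-\<^sup>\<gamma> = I\<^sup>1\<close>: the composite kernel is the indicator of \<open>t < x\<close>.
\<close>

lemma rl_kernel_convolution:
  assumes \<gamma>: "0 < \<gamma>" "\<gamma> < 1" and x: "x \<in> {a..b}" and t: "t \<in> {a..b}"
  shows "has_bochner_integral (lebesgue_on {a..b})
           (\<lambda>s. rl_kernel \<gamma> (x - s) * rl_kernel (1 - \<gamma>) (s - t)) (if t < x then 1 else 0)"
proof (cases "t < x")
  case True
  have hi: "((\<lambda>s. rl_kernel \<gamma> (x - s) * rl_kernel (1 - \<gamma>) (s - t)) has_integral 1) {a..b}"
    using rl_kernel_has_integral_mult[OF \<gamma> True]
    by (rule has_integral_on_superset) (use x t in \<open>auto simp: rl_kernel_def\<close>)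
  have ai: "(\<lambda>s. rl_kernel \<gamma> (x - s) * rl_kernel (1 - \<gamma>) (s - t)) absolutely_integrable_on {a..b}"
    by (rule nonnegative_absolutely_integrable_1[OF has_integral_integrable[OF hi]])
       (use \<gamma> in \<open>auto intro!: mult_nonneg_nonneg rl_kernel_nonneg\<close>)
  then have i: "integrable (lebesgue_on {a..b}) (\<lambda>s. rl_kernel \<gamma> (x - s) * rl_kernel (1 - \<gamma>) (s - t))"
    by (simp add: set_integrable_def integrable_restrict_space)
  then show ?thesis
    using True hi by (simp add: has_bochner_integral_iff lebesgue_integral_eq_integral integral_unique)
next
  case False
  then have "(\<lambda>s. rl_kernel \<gamma> (x - s) * rl_kernel (1 - \<gamma>) (s - t)) = (\<lambda>s. 0)"
    by (auto simp: rl_kernel_def)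
  with False show ?thesis by (simp only: if_False has_bochner_integral_zero)
qed

section \<open>Integrable functions with vanishing integrals\<close>

lemma sigma_finite_lebesgue: "sigma_finite_measure (lebesgue :: real measure)"
proof
  obtain A :: "real set set" where A: "countable A" "A \<subseteq> sets lborel" "\<Union>A = space lborel"
      "\<forall>a\<in>A. emeasure lborel a \<noteq> \<infinity>"
    using lborel.sigma_finite_countable by auto
  then show "\<exists>A::real set set. countable A \<and> A \<subseteq> sets lebesgue \<and> \<Union>A = space lebesgue \<and>
      (\<forall>a\<in>A. emeasure lebesgue a \<noteq> \<infinity>)"
    by (intro exI[of _ A]) auto
qed

text \<open>
  The sets over which \<open>h\<close> has integral zero form a Dynkin system containing the half-lines, which
  are stable under intersection and generate the Borel sets; a Lebesgue set differs from a Borel set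
  by a null set only.
\<close>

lemma AE_zero_if_integrals_atMost_zero:
  fixes h :: "real \<Rightarrow> real"
  assumes h: "integrable lebesgue h"
    and total: "(LINT t|lebesgue. h t) = 0"
    and zero: "\<And>c. (LINT t:{..c}|lebesgue. h t) = 0"
  shows "AE t in lebesgue. h t = 0"
proof (rule sigma_finite_measure.density_zero[OF sigma_finite_lebesgue h])
  have intA: "set_integrable lebesgue A h" if "A \<in> sets lebesgue" for A
    using h that unfolding set_integrable_def by (intro integrable_mult_indicator)
  have borel: "(LINT t:A|lebesgue. h t) = 0" if "A \<in> sets borel" for A
  proof -
    have s: "sets borel = sigma_sets UNIV (range (\<lambda>c::real. {..c}))"
      by (simp add: borel_eq_atMost)
    have "Int_stable (range (\<lambda>c::real. {..c}))" "range (\<lambda>c::real. {..c}) \<subseteq> Pow UNIV"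
        "A \<in> sigma_sets UNIV (range (\<lambda>c::real. {..c}))"
      using that by (auto simp: Int_stable_def s)
    then show ?thesis
    proof (induction rule: sigma_sets_induct_disjoint)
      case (basic A)
      then show ?case using zero by auto
    next
      case empty
      then show ?case by (simp add: set_lebesgue_integral_def)
    next
      case (compl A)
      then have A: "A \<in> sets lebesgue" by (simp flip: s)
      have "(LINT t:(UNIV - A)|lebesgue. h t) = (LINT t|lebesgue. h t - indicator A t *\<^sub>R h t)"
        by (auto simp: set_lebesgue_integral_def indicator_def intro!: Bochner_Integration.integral_cong)
      also have "\<dots> = 0"
        using intA[OF A] h total compl by (simp add: set_integrable_def set_lebesgue_integral_def)
      finally show ?case .
    next
      case (union A)
      then have A: "A i \<in> sets lebesgue" for i using s by (auto simp: image_subset_iff)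
      then have "(LINT t:(\<Union>i. A i)|lebesgue. h t) = (\<Sum>i. LINT t:A i|lebesgue. h t)"
        using union by (intro lebesgue_integral_countable_add intA) (auto simp: disjoint_family_on_def)
      with union show ?case by simp
    qed
  qed
  fix A assume A: "A \<in> sets (lebesgue :: real measure)"
  have "(LINT t:A|lebesgue. h t) = (LINT t:main_part lborel A|lebesgue. h t)"
  proof -
    have N: "AE t in lebesgue. t \<notin> null_part lborel A"
      by (intro AE_completion AE_notin_null_part A)
    have m: "main_part lborel A \<in> sets lebesgue"
      using main_part_sets[OF A] by simp
    have "t \<in> A \<longleftrightarrow> t \<in> main_part lborel A" if "t \<notin> null_part lborel A" for t
      using main_part_null_part_Un[OF A] that by blast
    then show ?thesis
      unfolding set_lebesgue_integral_def using N h A m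
      by (intro integral_cong_AE) (auto simp: indicator_def)
  qed
  then show "(LINT t:A|lebesgue. h t) = 0"
    using borel main_part_sets[OF A] by simp
qed

lemma id_borel_measurable_lebesgue_on [measurable]: "(\<lambda>t. t) \<in> borel_measurable (lebesgue_on (S :: real set))"
  by (intro measurable_restrict_space1 measurable_completion) simp

lemma AE_lebesgue_on_neq: "AE t in lebesgue_on {a..b}. t \<noteq> (c :: real)"
proof (subst AE_restrict_space_iff)
  show "AE t in lebesgue. t \<in> {a..b} \<longrightarrow> t \<noteq> c"
    using AE_completion[OF AE_lborel_singleton[of c]] by eventually_elim simp
qed simp

lemma AE_zero_if_initial_integrals_zero:
  fixes h :: "real \<Rightarrow> real"
  assumes h: "integrable (lebesgue_on {a..b}) h"
    and total: "(LINT t|lebesgue_on {a..b}. h t) = 0"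
    and initial: "\<And>c. c \<in> {a..b} \<Longrightarrow> (LINT t|lebesgue_on {a..b}. (if t < c then 1 else 0) * h t) = 0"
  shows "AE t in lebesgue_on {a..b}. h t = 0"
proof -
  let ?h = "\<lambda>t. indicator {a..b} t *\<^sub>R h t"
  have "AE t in lebesgue. ?h t = 0"
  proof (rule AE_zero_if_integrals_atMost_zero)
    show "integrable lebesgue ?h" using h by (simp add: integrable_restrict_space)
    show T: "(LINT t|lebesgue. ?h t) = 0" using total by (simp add: integral_restrict_space)
    fix c
    consider "c < a" | "c \<in> {a..b}" | "b < c" by fastforce
    then show "(LINT t:{..c}|lebesgue. ?h t) = 0"
    proof cases
      case 1
      then have "(\<lambda>t. indicator {..c} t *\<^sub>R ?h t) = (\<lambda>t. 0)" by (auto simp: indicator_def)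
      then show ?thesis by (simp add: set_lebesgue_integral_def)
    next
      case 2
      have "(LINT t:{..c}|lebesgue. ?h t) = (LINT t|lebesgue_on {a..b}. indicator {..c} t * h t)"
        by (simp add: set_lebesgue_integral_def integral_restrict_space mult.left_commute)
      also have "\<dots> = (LINT t|lebesgue_on {a..b}. (if t < c then 1 else 0) * h t)"
      proof (rule integral_cong_AE)
        have [measurable]: "h \<in> borel_measurable (lebesgue_on {a..b})"
          using h by auto
        show "(\<lambda>t. (if t < c then 1 else 0) * h t) \<in> borel_measurable (lebesgue_on {a..b})"
          "(\<lambda>t. indicator {..c} t * h t) \<in> borel_measurable (lebesgue_on {a..b})"
          by measurable
        show "AE t in lebesgue_on {a..b}. indicator {..c} t * h t = (if t < c then 1 else 0) * h t"
          using AE_lebesgue_on_neq[of c a b] by eventually_elim (auto simp: indicator_def)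
      qed
      finally show ?thesis using initial[OF 2] by simp
    next
      case 3
      then have "(\<lambda>t. indicator {..c} t *\<^sub>R ?h t) = ?h" by (auto simp: indicator_def)
      then show ?thesis using T by (simp add: set_lebesgue_integral_def)
    qed
  qed
  then have "AE t in lebesgue. t \<in> {a..b} \<longrightarrow> h t = 0"
    by eventually_elim (auto simp: indicator_def split: if_splits)
  then show ?thesis by (subst AE_restrict_space_iff) auto
qed

text \<open>
  The continuous functions \<open>max 0 (min 1 (n (c - t)))\<close> are dominated by one and converge pointwise
  to the indicator of \<open>t < c\<close>, so orthogonality passes to initial segments.
\<close>

lemma AE_zero_if_orthogonal_to_continuous:
  fixes w :: "real \<Rightarrow> real"
  assumes w: "integrable (lebesgue_on {a..b}) w"
    and orth: "\<And>v. continuous_on UNIV v \<Longrightarrow> (LINT t|lebesgue_on {a..b}. w t * v t) = 0"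
  shows "AE t in lebesgue_on {a..b}. w t = 0"
proof (rule AE_zero_if_initial_integrals_zero[OF w])
  show "(LINT t|lebesgue_on {a..b}. w t) = 0" using orth[of "\<lambda>_. 1"] by simp
  fix c
  define v where "v n t = max 0 (min 1 (real n * (c - t)))" for n t
  have v_cont: "continuous_on UNIV (v n)" for n
    unfolding v_def by (intro continuous_intros)
  have v_bound: "\<bar>v n t\<bar> \<le> 1" for n t by (auto simp: v_def)
  have v_lim: "(\<lambda>n. v n t) \<longlonglongrightarrow> (if t < c then 1 else 0)" for t
  proof (cases "t < c")
    case True
    obtain N :: nat where N: "1 / (c - t) < real N" using reals_Archimedean2 by blast
    have "v n t = 1" if "N \<le> n" for n
    proof -
      have "1 / (c - t) \<le> real n" using N that by linarith
      then have "1 \<le> real n * (c - t)" using True by (simp add: divide_le_eq)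
      then show ?thesis by (simp add: v_def)
    qed
    then have "\<forall>\<^sub>F n in sequentially. v n t = 1" by (rule eventually_sequentiallyI)
    then show ?thesis using True by (simp add: tendsto_eventually)
  next
    case False
    then have "v n t = 0" for n
      using mult_nonneg_nonpos[of "real n" "c - t"] by (simp add: v_def)
    with False show ?thesis by simp
  qed
  have v_meas [measurable]: "v n \<in> borel_measurable (lebesgue_on {a..b})" for n
    by (intro continuous_imp_measurable_on_sets_lebesgue continuous_on_subset[OF v_cont]) auto
  have [measurable]: "w \<in> borel_measurable (lebesgue_on {a..b})" using w by auto
  have "(\<lambda>n. LINT t|lebesgue_on {a..b}. w t * v n t) \<longlonglongrightarrow>
      (LINT t|lebesgue_on {a..b}. w t * (if t < c then 1 else 0))"
  proof (rule integral_dominated_convergence[where w = "\<lambda>t. \<bar>w t\<bar>"])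
    show "AE t in lebesgue_on {a..b}. (\<lambda>n. w t * v n t) \<longlonglongrightarrow> w t * (if t < c then 1 else 0)"
      using v_lim by (intro AE_I2 tendsto_mult_left)
    show "AE t in lebesgue_on {a..b}. norm (w t * v n t) \<le> \<bar>w t\<bar>" for n
      using v_bound[of n] by (intro AE_I2) (simp add: abs_mult mult_left_le)
    show "integrable (lebesgue_on {a..b}) (\<lambda>t. \<bar>w t\<bar>)" using w by simp
  qed measurable
  moreover have "(\<lambda>n. LINT t|lebesgue_on {a..b}. w t * v n t) = (\<lambda>n. 0)"
    using orth[OF v_cont] by simp
  ultimately show "(LINT t|lebesgue_on {a..b}. (if t < c then 1 else 0) * w t) = 0"
    by (simp add: LIMSEQ_const_iff mult.commute)
qed

text \<open>
  The end points belong to the conclusion: a continuous nonnegative function on \<open>[a,b]\<close> with zero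
  integral vanishes on the whole closed interval.
\<close>

lemma continuous_AE_zero_imp_zero:
  fixes f :: "real \<Rightarrow> real"
  assumes f: "continuous_on {a..b} f" and "a < b" and z: "AE t in lebesgue_on {a..b}. f t = 0"
    and x: "x \<in> {a..b}"
  shows "f x = 0"
proof -
  have c: "continuous_on (cbox a b) (\<lambda>x. \<bar>f x\<bar>)" using f by (simp add: continuous_on_rabs)
  then have i: "integrable (lebesgue_on {a..b}) (\<lambda>x. \<bar>f x\<bar>)"
    using continuous_imp_integrable by fastforce
  have "(LINT x|lebesgue_on {a..b}. \<bar>f x\<bar>) = 0"
    using z by (intro integral_eq_zero_AE) auto
  then have "((\<lambda>x. \<bar>f x\<bar>) has_integral 0) (cbox a b)"
    using has_integral_integral_lebesgue_on[OF i] by simp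
  from has_integral_0_cbox_imp_0[OF c _ this] show ?thesis
    using \<open>a < b\<close> x by auto
qed

section \<open>Integral operators with nonnegative kernels\<close>

text \<open>
  A kernel whose rows have uniformly bounded integrals. This bound makes the integral operator
  map bounded functions to bounded functions, and it is what Fubini's theorem needs for adjointness.
\<close>

locale bounded_kernel = finite_measure M for M :: "real measure" +
  fixes K :: "real \<Rightarrow> real \<Rightarrow> real" and C :: real
  assumes K_measurable [measurable]: "case_prod K \<in> borel_measurable (M \<Otimes>\<^sub>M M)"
    and K_nonneg: "0 \<le> K x t"
    and K_integrable: "x \<in> space M \<Longrightarrow> integrable M (K x)"
    and K_bound: "x \<in> space M \<Longrightarrow> (LINT t|M. K x t) \<le> C"
begin

lemma K_measurable_row: "x \<in> space M \<Longrightarrow> K x \<in> borel_measurable M"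
  using K_integrable by auto

lemma integrable_kernel_mult:
  assumes f: "f \<in> borel_measurable M" and B: "AE t in M. \<bar>f t\<bar> \<le> B" and x: "x \<in> space M"
  shows "integrable M (\<lambda>t. K x t * f t)"
proof (rule Bochner_Integration.integrable_bound)
  show "integrable M (\<lambda>t. B * K x t)" using K_integrable[OF x] by simp
  show "(\<lambda>t. K x t * f t) \<in> borel_measurable M"
    using f K_measurable_row[OF x] by simp
  show "AE t in M. norm (K x t * f t) \<le> norm (B * K x t)"
    using B by eventually_elim
      (use K_nonneg in \<open>auto simp: abs_mult mult.commute intro!: mult_mono\<close>)
qed

lemma abs_kernel_integral_le:
  assumes f: "f \<in> borel_measurable M" and B: "AE t in M. \<bar>f t\<bar> \<le> B" and x: "x \<in> space M"
    and "0 \<le> B"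
  shows "\<bar>LINT t|M. K x t * f t\<bar> \<le> B * C"
proof -
  have "\<bar>LINT t|M. K x t * f t\<bar> \<le> (LINT t|M. \<bar>K x t * f t\<bar>)"
    using integral_norm_bound[of M "\<lambda>t. K x t * f t"] by simp
  also have "\<dots> \<le> (LINT t|M. B * K x t)"
  proof (rule integral_mono_AE)
    show "integrable M (\<lambda>t. \<bar>K x t * f t\<bar>)"
      using integrable_kernel_mult[OF f B x] by simp
    show "integrable M (\<lambda>t. B * K x t)" using K_integrable[OF x] by simp
    show "AE t in M. \<bar>K x t * f t\<bar> \<le> B * K x t"
      using B by eventually_elim
        (use K_nonneg in \<open>auto simp: abs_mult mult.commute intro!: mult_right_mono\<close>)
  qed
  also have "\<dots> \<le> B * C"
    using K_bound[OF x] \<open>0 \<le> B\<close> by (simp add: mult_left_mono)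
  finally show ?thesis .
qed

lemma measurable_kernel_integral:
  assumes [measurable]: "f \<in> borel_measurable M"
  shows "(\<lambda>x. LINT t|M. K x t * f t) \<in> borel_measurable M"
  by measurable

text \<open>
  Fractional integration by parts in kernel form: for bounded \<open>f\<close> and \<open>g\<close> the integrand
  \<open>g x * K x t * f t\<close> is integrable on the product, and the order of integration can be exchanged.
\<close>

lemma kernel_integral_adjoint:
  assumes f [measurable]: "f \<in> borel_measurable M" and B: "\<And>t. t \<in> space M \<Longrightarrow> \<bar>f t\<bar> \<le> B"
    and g [measurable]: "g \<in> borel_measurable M" and D: "\<And>t. t \<in> space M \<Longrightarrow> \<bar>g t\<bar> \<le> D"
  shows "(LINT x|M. g x * (LINT t|M. K x t * f t)) = (LINT t|M. (LINT x|M. K x t * g x) * f t)"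
proof -
  interpret P: pair_sigma_finite M M ..
  have BAE: "AE t in M. \<bar>f t\<bar> \<le> B" using B by (intro AE_I2)
  have row: "integrable M (\<lambda>t. K x t * f t)" if "x \<in> space M" for x
    by (rule integrable_kernel_mult[OF f BAE that])
  have i: "integrable (M \<Otimes>\<^sub>M M) (\<lambda>(x, t). g x * (K x t * f t))"
  proof (rule P.Fubini_integrable)
    show "(\<lambda>(x, t). g x * (K x t * f t)) \<in> borel_measurable (M \<Otimes>\<^sub>M M)" by measurable
    show "AE x in M. integrable M (\<lambda>t. case (x, t) of (x, t) \<Rightarrow> g x * (K x t * f t))"
      using row by (intro AE_I2) simp
    show "integrable M (\<lambda>x. LINT t|M. norm (case (x, t) of (x, t) \<Rightarrow> g x * (K x t * f t)))"
    proof (rule integrable_const_bound)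
      show "AE x in M. norm (LINT t|M. norm (case (x, t) of (x, t) \<Rightarrow> g x * (K x t * f t))) \<le> \<bar>D\<bar> * (\<bar>B\<bar> * C)"
      proof (rule AE_I2)
        fix x assume x: "x \<in> space M"
        have "(LINT t|M. norm (case (x, t) of (x, t) \<Rightarrow> g x * (K x t * f t))) =
            \<bar>g x\<bar> * (LINT t|M. K x t * \<bar>f t\<bar>)"
          by (simp add: abs_mult K_nonneg)
        moreover have "\<bar>LINT t|M. K x t * \<bar>f t\<bar>\<bar> \<le> \<bar>B\<bar> * C"
          by (rule abs_kernel_integral_le[OF _ _ x]) (use BAE in \<open>auto elim: eventually_mono\<close>)
        moreover have "\<bar>g x\<bar> \<le> \<bar>D\<bar>" using D[OF x] by simp
        ultimately show "norm (LINT t|M. norm (case (x, t) of (x, t) \<Rightarrow> g x * (K x t * f t))) \<le> \<bar>D\<bar> * (\<bar>B\<bar> * C)"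
          by (simp only: real_norm_def abs_mult abs_abs) (intro mult_mono, auto)
      qed
    qed measurable
  qed
  have "(LINT x|M. g x * (LINT t|M. K x t * f t)) = (LINT x|M. LINT t|M. g x * (K x t * f t))"
    by simp
  also have "\<dots> = (LINT t|M. LINT x|M. g x * (K x t * f t))"
    by (rule P.Fubini_integral[OF i, symmetric])
  also have "\<dots> = (LINT t|M. LINT x|M. (K x t * g x) * f t)"
    by (simp add: mult.assoc mult.left_commute)
  also have "\<dots> = (LINT t|M. (LINT x|M. K x t * g x) * f t)"
    by simp
  finally show ?thesis .
qed

end

text \<open>
  Fubini's theorem applies for every single \<open>x\<close> and every integrable \<open>f\<close>, bounded or not, because
  the iterated integral of \<open>K x s * H s t * \<bar>f t\<bar>\<close> in the order \<open>s\<close>, \<open>t\<close> is at most the integral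
  of \<open>\<bar>f\<bar>\<close>. The inner integral may fail to exist for some \<open>s\<close>; these form a null set.
\<close>

lemma kernel_integral_compose:
  fixes K H U :: "real \<Rightarrow> real \<Rightarrow> real"
  assumes M: "finite_measure M"
    and K [measurable]: "case_prod K \<in> borel_measurable (M \<Otimes>\<^sub>M M)" and Kpos: "\<And>x t. 0 \<le> K x t"
    and H [measurable]: "case_prod H \<in> borel_measurable (M \<Otimes>\<^sub>M M)" and Hpos: "\<And>x t. 0 \<le> H x t"
    and KH: "\<And>t. t \<in> space M \<Longrightarrow> has_bochner_integral M (\<lambda>s. K x s * H s t) (U x t)"
    and U: "\<And>t. t \<in> space M \<Longrightarrow> \<bar>U x t\<bar> \<le> 1"
    and f: "integrable M f" and x: "x \<in> space M"
  shows "(LINT s|M. K x s * (LINT t|M. H s t * f t)) = (LINT t|M. U x t * f t)"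
proof -
  interpret finite_measure M by fact
  interpret P: pair_sigma_finite M M ..
  have f' [measurable]: "f \<in> borel_measurable M" using f by auto
  have Kx [measurable]: "K x \<in> borel_measurable M"
    using measurable_Pair2[OF K x] by simp
  have inner: "(LINT s|M. f t * (K x s * H s t)) = U x t * f t" if "t \<in> space M" for t
    using KH[OF that] by (simp add: has_bochner_integral_iff)
  have i: "integrable (M \<Otimes>\<^sub>M M) (\<lambda>(t, s). f t * (K x s * H s t))"
  proof (rule P.Fubini_integrable)
    show "(\<lambda>(t, s). f t * (K x s * H s t)) \<in> borel_measurable (M \<Otimes>\<^sub>M M)" by measurable
    show "AE t in M. integrable M (\<lambda>s. case (t, s) of (t, s) \<Rightarrow> f t * (K x s * H s t))"
      using KH by (intro AE_I2) (auto simp: has_bochner_integral_iff)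
    show "integrable M (\<lambda>t. LINT s|M. norm (case (t, s) of (t, s) \<Rightarrow> f t * (K x s * H s t)))"
    proof (rule Bochner_Integration.integrable_bound[OF f])
      show "AE t in M. norm (LINT s|M. norm (case (t, s) of (t, s) \<Rightarrow> f t * (K x s * H s t))) \<le> norm (f t)"
      proof (rule AE_I2)
        fix t assume t: "t \<in> space M"
        have "(LINT s|M. norm (case (t, s) of (t, s) \<Rightarrow> f t * (K x s * H s t))) = \<bar>f t\<bar> * U x t"
          using KH[OF t] by (simp add: has_bochner_integral_iff abs_mult Kpos Hpos)
        then show "norm (LINT s|M. norm (case (t, s) of (t, s) \<Rightarrow> f t * (K x s * H s t))) \<le> norm (f t)"
          using U[OF t] by (simp only: real_norm_def abs_mult abs_abs mult_left_le abs_ge_zero)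
      qed
    qed measurable
  qed
  have "(LINT s|M. K x s * (LINT t|M. H s t * f t)) = (LINT s|M. LINT t|M. f t * (K x s * H s t))"
    by (simp add: mult.commute mult.left_commute flip: integral_mult_right_zero)
  also have "\<dots> = (LINT t|M. LINT s|M. f t * (K x s * H s t))"
    by (rule P.Fubini_integral[OF i])
  also have "\<dots> = (LINT t|M. U x t * f t)"
    using inner by (intro Bochner_Integration.integral_cong) auto
  finally show ?thesis .
qed

section \<open>Left and right fractional kernels\<close>

lemma fst_snd_borel_measurable_lebesgue_on [measurable]:
  "fst \<in> borel_measurable (lebesgue_on S \<Otimes>\<^sub>M lebesgue_on (T :: real set))"
  "snd \<in> borel_measurable (lebesgue_on (S :: real set) \<Otimes>\<^sub>M lebesgue_on T)"
  using measurable_compose[OF measurable_fst id_borel_measurable_lebesgue_on]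
    measurable_compose[OF measurable_snd id_borel_measurable_lebesgue_on] by simp_all

definition left_kernel :: "real \<Rightarrow> real \<Rightarrow> real \<Rightarrow> real" where
  "left_kernel \<gamma> x t = rl_kernel \<gamma> (x - t)"

definition right_kernel :: "real \<Rightarrow> real \<Rightarrow> real \<Rightarrow> real" where
  "right_kernel \<gamma> x t = rl_kernel \<gamma> (t - x)"

lemma left_kernel_measurable [measurable]:
  "case_prod (left_kernel \<gamma>) \<in> borel_measurable (lebesgue_on {a..b} \<Otimes>\<^sub>M lebesgue_on {a..b})"
  unfolding left_kernel_def case_prod_beta by measurable

lemma right_kernel_measurable [measurable]:
  "case_prod (right_kernel \<gamma>) \<in> borel_measurable (lebesgue_on {a..b} \<Otimes>\<^sub>M lebesgue_on {a..b})"
  unfolding right_kernel_def case_prod_beta by measurable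

text \<open>
  This is why the adjoint of a left fractional integral is a right fractional integral.
\<close>

lemma left_kernel_transpose: "left_kernel \<gamma> x t = right_kernel \<gamma> t x"
  by (simp add: left_kernel_def right_kernel_def)

lemma left_kernel_compose:
  assumes "0 < \<gamma>" "\<gamma> < 1" "x \<in> {a..b}" "t \<in> {a..b}"
  shows "has_bochner_integral (lebesgue_on {a..b})
           (\<lambda>s. left_kernel \<gamma> x s * left_kernel (1 - \<gamma>) s t) (if t < x then 1 else 0)"
  unfolding left_kernel_def by (rule rl_kernel_convolution[OF assms])

text \<open>
  Reading the product in the opposite order exchanges \<open>\<gamma>\<close> with \<open>1 - \<gamma>\<close> and the roles of \<open>x\<close> and
  \<open>t\<close>, so the left-sided convolution identity covers this case.
\<close>

lemma right_kernel_compose: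
  assumes "0 < \<gamma>" "\<gamma> < 1" "x \<in> {a..b}" "t \<in> {a..b}"
  shows "has_bochner_integral (lebesgue_on {a..b})
           (\<lambda>s. right_kernel \<gamma> x s * right_kernel (1 - \<gamma>) s t) (if x < t then 1 else 0)"
  using rl_kernel_convolution[of "1 - \<gamma>" t a b x] assms
  by (simp add: right_kernel_def mult.commute)

lemma rl_kernel_antimono:
  assumes "0 < \<gamma>" "\<gamma> < 1" "0 < r" "r \<le> s"
  shows "rl_kernel \<gamma> s \<le> rl_kernel \<gamma> r"
  using assms by (auto simp: rl_kernel_def intro!: divide_right_mono powr_mono2' less_imp_le[OF Gamma_real_pos])

text \<open>
  Used to bound the rows of a kernel: multiplied by the complementary kernel, which is bounded below
  by a positive constant, a row has a known integral of at most one.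
\<close>

lemma integrable_factor:
  fixes f g :: "'a \<Rightarrow> real"
  assumes g: "has_bochner_integral M (\<lambda>s. f s * g s) u" and u: "u \<le> 1"
    and f: "f \<in> borel_measurable M" "\<And>s. 0 \<le> f s" and c: "0 < c" "AE s in M. c \<le> g s"
  shows "integrable M f" "(LINT s|M. f s) \<le> 1 / c"
proof -
  have "has_bochner_integral M (\<lambda>s. f s * g s * (1 / c)) (u * (1 / c))"
    by (intro has_bochner_integral_mult_left g)
  then have i: "integrable M (\<lambda>s. f s * g s / c)" "(LINT s|M. f s * g s / c) = u / c"
    unfolding has_bochner_integral_iff by simp_all
  have le: "AE s in M. f s \<le> f s * g s / c"
    using c(2) by eventually_elim (use c(1) f(2) in \<open>simp add: pos_le_divide_eq mult_left_mono\<close>)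
  have "AE s in M. norm (f s) \<le> norm (f s * g s / c)"
    using le by eventually_elim (simp only: real_norm_def abs_of_nonneg[OF f(2)] order_trans[OF _ abs_ge_self])
  then show f_int: "integrable M f"
    by (rule Bochner_Integration.integrable_bound[OF i(1) f(1)])
  have "(LINT s|M. f s) \<le> u / c"
    using integral_mono_AE[OF f_int i(1) le] unfolding i(2) .
  also have "\<dots> \<le> 1 / c" using u c by (simp add: divide_right_mono)
  finally show "(LINT s|M. f s) \<le> 1 / c" .
qed

lemma bounded_kernel_left:
  assumes \<gamma>: "0 < \<gamma>" "\<gamma> < 1" and ab: "a < b"
  shows "bounded_kernel (lebesgue_on {a..b}) (left_kernel \<gamma>) (1 / rl_kernel (1 - \<gamma>) (b - a))"
proof -
  interpret finite_measure "lebesgue_on {a..b}"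
    by (rule finite_measure_lebesgue_on) simp
  have g: "0 < rl_kernel (1 - \<gamma>) (b - a)"
    using \<gamma> ab by (simp add: rl_kernel_def Gamma_real_pos)
  have row: "left_kernel \<gamma> x \<in> borel_measurable (lebesgue_on {a..b})" for x
    unfolding left_kernel_def[abs_def] by measurable
  \<comment> \<open>At \<open>s = a\<close> the kernel is cut off to zero, so the lower bound holds almost everywhere only.\<close>
  have lower: "AE s in lebesgue_on {a..b}. rl_kernel (1 - \<gamma>) (b - a) \<le> left_kernel (1 - \<gamma>) s a"
    using AE_lebesgue_on_neq[of a a b] AE_space
    by eventually_elim (use \<gamma> in \<open>auto simp: left_kernel_def intro!: rl_kernel_antimono\<close>)
  show ?thesis
  proof
    fix x assume x: "x \<in> space (lebesgue_on {a..b})"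
    have h: "has_bochner_integral (lebesgue_on {a..b})
          (\<lambda>s. left_kernel \<gamma> x s * left_kernel (1 - \<gamma>) s a) (if a < x then 1 else 0)"
      using x ab by (intro left_kernel_compose \<gamma>) auto
    note * = integrable_factor[OF h _ row _ g lower]
    show "integrable (lebesgue_on {a..b}) (left_kernel \<gamma> x)"
      by (rule *) (use \<gamma> in \<open>auto simp: left_kernel_def rl_kernel_nonneg\<close>)
    show "(LINT t|lebesgue_on {a..b}. left_kernel \<gamma> x t) \<le> 1 / rl_kernel (1 - \<gamma>) (b - a)"
      by (rule *) (use \<gamma> in \<open>auto simp: left_kernel_def rl_kernel_nonneg\<close>)
  qed (use \<gamma> in \<open>auto simp: left_kernel_def rl_kernel_nonneg intro: left_kernel_measurable[unfolded left_kernel_def]\<close>)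
qed

lemma bounded_kernel_right:
  assumes \<gamma>: "0 < \<gamma>" "\<gamma> < 1" and ab: "a < b"
  shows "bounded_kernel (lebesgue_on {a..b}) (right_kernel \<gamma>) (1 / rl_kernel (1 - \<gamma>) (b - a))"
proof -
  interpret finite_measure "lebesgue_on {a..b}"
    by (rule finite_measure_lebesgue_on) simp
  have g: "0 < rl_kernel (1 - \<gamma>) (b - a)"
    using \<gamma> ab by (simp add: rl_kernel_def Gamma_real_pos)
  have row: "right_kernel \<gamma> x \<in> borel_measurable (lebesgue_on {a..b})" for x
    unfolding right_kernel_def[abs_def] by measurable
  \<comment> \<open>At \<open>s = b\<close> the kernel is cut off to zero, so the lower bound holds almost everywhere only.\<close>
  have lower: "AE s in lebesgue_on {a..b}. rl_kernel (1 - \<gamma>) (b - a) \<le> right_kernel (1 - \<gamma>) s b"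
    using AE_lebesgue_on_neq[of b a b] AE_space
    by eventually_elim (use \<gamma> in \<open>auto simp: right_kernel_def intro!: rl_kernel_antimono\<close>)
  show ?thesis
  proof
    fix x assume x: "x \<in> space (lebesgue_on {a..b})"
    have h: "has_bochner_integral (lebesgue_on {a..b})
          (\<lambda>s. right_kernel \<gamma> x s * right_kernel (1 - \<gamma>) s b) (if x < b then 1 else 0)"
      using x ab by (intro right_kernel_compose \<gamma>) auto
    note * = integrable_factor[OF h _ row _ g lower]
    show "integrable (lebesgue_on {a..b}) (right_kernel \<gamma> x)"
      by (rule *) (use \<gamma> in \<open>auto simp: right_kernel_def rl_kernel_nonneg\<close>)
    show "(LINT t|lebesgue_on {a..b}. right_kernel \<gamma> x t) \<le> 1 / rl_kernel (1 - \<gamma>) (b - a)"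
      by (rule *) (use \<gamma> in \<open>auto simp: right_kernel_def rl_kernel_nonneg\<close>)
  qed (use \<gamma> in \<open>auto simp: right_kernel_def rl_kernel_nonneg intro: right_kernel_measurable[unfolded right_kernel_def]\<close>)
qed

section \<open>Inversion of Abel's integral equation\<close>

text \<open>
  Two kernels, of complementary orders, whose compositions in both orders are the kernel \<open>U\<close> of a
  primitive, taken from the left or from the right end point; \<open>U_determines\<close> says that a function is
  determined almost everywhere by this primitive.
\<close>

locale abel_pair =
  K: bounded_kernel "lebesgue_on {a..b}" K C + H: bounded_kernel "lebesgue_on {a..b}" H D
  for a b :: real and K H C D +
  fixes U :: "real \<Rightarrow> real \<Rightarrow> real"
  assumes KH: "\<And>x t. x \<in> {a..b} \<Longrightarrow> t \<in> {a..b} \<Longrightarrow>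
      has_bochner_integral (lebesgue_on {a..b}) (\<lambda>s. K x s * H s t) (U x t)"
    and HK: "\<And>x t. x \<in> {a..b} \<Longrightarrow> t \<in> {a..b} \<Longrightarrow>
      has_bochner_integral (lebesgue_on {a..b}) (\<lambda>s. H x s * K s t) (U x t)"
    and U_le: "\<And>x t. \<bar>U x t\<bar> \<le> 1"
    and U_measurable: "\<And>x. U x \<in> borel_measurable (lebesgue_on {a..b})"
    and U_determines: "\<And>h. integrable (lebesgue_on {a..b}) h \<Longrightarrow>
      (\<And>x. x \<in> {a..b} \<Longrightarrow> (LINT t|lebesgue_on {a..b}. U x t * h t) = 0) \<Longrightarrow>
      AE t in lebesgue_on {a..b}. h t = 0"
begin

lemma compose_KH:
  assumes "integrable (lebesgue_on {a..b}) f" "x \<in> {a..b}"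
  shows "(LINT s|lebesgue_on {a..b}. K x s * (LINT t|lebesgue_on {a..b}. H s t * f t)) =
    (LINT t|lebesgue_on {a..b}. U x t * f t)"
  by (rule kernel_integral_compose)
     (use assms in \<open>auto intro!: K.finite_measure_axioms K.K_measurable H.K_measurable K.K_nonneg H.K_nonneg KH U_le\<close>)

lemma compose_HK:
  assumes "integrable (lebesgue_on {a..b}) f" "x \<in> {a..b}"
  shows "(LINT s|lebesgue_on {a..b}. H x s * (LINT t|lebesgue_on {a..b}. K s t * f t)) =
    (LINT t|lebesgue_on {a..b}. U x t * f t)"
  by (rule kernel_integral_compose)
     (use assms in \<open>auto intro!: K.finite_measure_axioms K.K_measurable H.K_measurable K.K_nonneg H.K_nonneg HK U_le\<close>)

lemma integrable_U_mult:
  assumes "integrable (lebesgue_on {a..b}) f"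
  shows "integrable (lebesgue_on {a..b}) (\<lambda>t. U x t * f t)"
  by (rule Bochner_Integration.integrable_bound[OF assms])
     (use assms U_measurable[of x] U_le[of x] in \<open>auto simp: abs_mult mult_left_le_one_le\<close>)

text \<open>
  With \<open>K\<close>, \<open>H\<close>, \<open>U\<close> also denoting the operators, \<open>H f = U g\<close> yields
  \<open>U f = K (H f) = K (U g) = K (H (K g)) = U (K g)\<close>, hence \<open>f = K g\<close> almost everywhere.
\<close>

lemma abel_inversion:
  assumes f: "integrable (lebesgue_on {a..b}) f"
    and g: "g \<in> borel_measurable (lebesgue_on {a..b})" "AE t in lebesgue_on {a..b}. \<bar>g t\<bar> \<le> B" "0 \<le> B"
    and eq: "\<And>x. x \<in> {a..b} \<Longrightarrow>
      (LINT t|lebesgue_on {a..b}. H x t * f t) = (LINT t|lebesgue_on {a..b}. U x t * g t)"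
  shows "AE x in lebesgue_on {a..b}. f x = (LINT t|lebesgue_on {a..b}. K x t * g t)"
proof -
  let ?M = "lebesgue_on {a..b}" and ?k = "\<lambda>x. LINT t|lebesgue_on {a..b}. K x t * g t"
  have gi: "integrable ?M g"
    by (rule K.integrable_const_bound[OF _ g(1)]) (use g(2) in simp)
  have ki: "integrable ?M ?k"
    by (rule K.integrable_const_bound[OF _ K.measurable_kernel_integral[OF g(1)]])
       (auto intro!: AE_I2 K.abs_kernel_integral_le g)
  have "AE x in ?M. f x - ?k x = 0"
  proof (rule U_determines)
    show "integrable ?M (\<lambda>x. f x - ?k x)" using f ki by simp
    fix x assume x: "x \<in> {a..b}"
    have "(LINT t|?M. U x t * f t) = (LINT s|?M. K x s * (LINT t|?M. H s t * f t))"
      by (rule compose_KH[OF f x, symmetric])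
    also have "\<dots> = (LINT s|?M. K x s * (LINT t|?M. H s t * ?k t))"
      using eq compose_HK[OF gi] by (intro Bochner_Integration.integral_cong) auto
    also have "\<dots> = (LINT t|?M. U x t * ?k t)"
      by (rule compose_KH[OF ki x])
    finally show "(LINT t|?M. U x t * (f t - ?k t)) = 0"
      using integrable_U_mult[OF f] integrable_U_mult[OF ki]
      by (simp add: right_diff_distrib)
  qed
  then show ?thesis by simp
qed

end

lemma abel_pair_left:
  assumes \<gamma>: "0 < \<gamma>" "\<gamma> < 1" and ab: "a < b"
  shows "abel_pair a b (left_kernel \<gamma>) (left_kernel (1 - \<gamma>))
    (1 / rl_kernel (1 - \<gamma>) (b - a)) (1 / rl_kernel \<gamma> (b - a)) (\<lambda>x t. if t < x then 1 else 0)"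
proof -
  interpret K: bounded_kernel "lebesgue_on {a..b}" "left_kernel \<gamma>" "1 / rl_kernel (1 - \<gamma>) (b - a)"
    by (rule bounded_kernel_left[OF \<gamma> ab])
  interpret H: bounded_kernel "lebesgue_on {a..b}" "left_kernel (1 - \<gamma>)" "1 / rl_kernel \<gamma> (b - a)"
    using bounded_kernel_left[of "1 - \<gamma>" a b] \<gamma> ab by simp
  show ?thesis
  proof
    fix h :: "real \<Rightarrow> real"
    assume h: "integrable (lebesgue_on {a..b}) h"
      and z: "\<And>x. x \<in> {a..b} \<Longrightarrow> (LINT t|lebesgue_on {a..b}. (if t < x then 1 else 0) * h t) = 0"
    have [measurable]: "h \<in> borel_measurable (lebesgue_on {a..b})" using h by auto
    have "(LINT t|lebesgue_on {a..b}. h t) = (LINT t|lebesgue_on {a..b}. (if t < b then 1 else 0) * h t)"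
    proof (rule integral_cong_AE)
      show "AE t in lebesgue_on {a..b}. h t = (if t < b then 1 else 0) * h t"
        using AE_lebesgue_on_neq[of b a b] AE_space by eventually_elim auto
    qed measurable
    then show "AE t in lebesgue_on {a..b}. h t = 0"
      using h z ab by (intro AE_zero_if_initial_integrals_zero) auto
  next
    fix x show "(\<lambda>t. if t < x then 1 else 0 :: real) \<in> borel_measurable (lebesgue_on {a..b})"
      by measurable
  next
    fix x t assume xt: "x \<in> {a..b}" "t \<in> {a..b}"
    show "has_bochner_integral (lebesgue_on {a..b})
        (\<lambda>s. left_kernel \<gamma> x s * left_kernel (1 - \<gamma>) s t) (if t < x then 1 else 0)"
      by (rule left_kernel_compose[OF \<gamma> xt])
    show "has_bochner_integral (lebesgue_on {a..b})
        (\<lambda>s. left_kernel (1 - \<gamma>) x s * left_kernel \<gamma> s t) (if t < x then 1 else 0)"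
      using left_kernel_compose[of "1 - \<gamma>", OF _ _ xt] \<gamma> by simp
  qed simp
qed

lemma abel_pair_right:
  assumes \<gamma>: "0 < \<gamma>" "\<gamma> < 1" and ab: "a < b"
  shows "abel_pair a b (right_kernel \<gamma>) (right_kernel (1 - \<gamma>))
    (1 / rl_kernel (1 - \<gamma>) (b - a)) (1 / rl_kernel \<gamma> (b - a)) (\<lambda>x t. if x < t then 1 else 0)"
proof -
  interpret K: bounded_kernel "lebesgue_on {a..b}" "right_kernel \<gamma>" "1 / rl_kernel (1 - \<gamma>) (b - a)"
    by (rule bounded_kernel_right[OF \<gamma> ab])
  interpret H: bounded_kernel "lebesgue_on {a..b}" "right_kernel (1 - \<gamma>)" "1 / rl_kernel \<gamma> (b - a)"
    using bounded_kernel_right[of "1 - \<gamma>" a b] \<gamma> ab by simp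
  show ?thesis
  proof
    fix h :: "real \<Rightarrow> real"
    assume h: "integrable (lebesgue_on {a..b}) h"
      and z: "\<And>x. x \<in> {a..b} \<Longrightarrow> (LINT t|lebesgue_on {a..b}. (if x < t then 1 else 0) * h t) = 0"
    have [measurable]: "h \<in> borel_measurable (lebesgue_on {a..b})" using h by auto
    have total: "(LINT t|lebesgue_on {a..b}. h t) = 0"
    proof -
      have "(LINT t|lebesgue_on {a..b}. h t) = (LINT t|lebesgue_on {a..b}. (if a < t then 1 else 0) * h t)"
      proof (rule integral_cong_AE)
        show "AE t in lebesgue_on {a..b}. h t = (if a < t then 1 else 0) * h t"
          using AE_lebesgue_on_neq[of a a b] AE_space by eventually_elim auto
      qed measurable
      with z ab show ?thesis by simp
    qed
    show "AE t in lebesgue_on {a..b}. h t = 0"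
    proof (rule AE_zero_if_initial_integrals_zero[OF h total])
      fix c assume c: "c \<in> {a..b}"
      have i: "integrable (lebesgue_on {a..b}) (\<lambda>t. (if c < t then 1 else 0) * h t)"
        by (rule Bochner_Integration.integrable_bound[OF h]) auto
      have "(LINT t|lebesgue_on {a..b}. (if t < c then 1 else 0) * h t) =
        (LINT t|lebesgue_on {a..b}. h t - (if c < t then 1 else 0) * h t)"
      proof (rule integral_cong_AE)
        show "AE t in lebesgue_on {a..b}. (if t < c then 1 else 0) * h t = h t - (if c < t then 1 else 0) * h t"
          using AE_lebesgue_on_neq[of c a b] by eventually_elim auto
      qed measurable
      also have "\<dots> = 0" using h i z[OF c] total by simp
      finally show "(LINT t|lebesgue_on {a..b}. (if t < c then 1 else 0) * h t) = 0" .
    qed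
  next
    fix x show "(\<lambda>t. if x < t then 1 else 0 :: real) \<in> borel_measurable (lebesgue_on {a..b})"
      by measurable
  next
    fix x t assume xt: "x \<in> {a..b}" "t \<in> {a..b}"
    show "has_bochner_integral (lebesgue_on {a..b})
        (\<lambda>s. right_kernel \<gamma> x s * right_kernel (1 - \<gamma>) s t) (if x < t then 1 else 0)"
      by (rule right_kernel_compose[OF \<gamma> xt])
    show "has_bochner_integral (lebesgue_on {a..b})
        (\<lambda>s. right_kernel (1 - \<gamma>) x s * right_kernel \<gamma> s t) (if x < t then 1 else 0)"
      using right_kernel_compose[of "1 - \<gamma>", OF _ _ xt] \<gamma> by simp
  qed simp
qed

section \<open>Riemann-Liouville operators as integral operators\<close>

lemma set_integral_eq_lebesgue_on:
  fixes f g :: "real \<Rightarrow> real"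
  assumes S: "S \<in> sets lebesgue" "S \<subseteq> T" "T \<in> sets lebesgue"
    and fg: "\<And>t. t \<in> S \<Longrightarrow> f t = g t" and g0: "\<And>t. t \<in> T - S \<Longrightarrow> g t = 0"
  shows "(LINT t:S|lebesgue. f t) = (LINT t|lebesgue_on T. g t)"
    and "f absolutely_integrable_on S \<longleftrightarrow> integrable (lebesgue_on T) g"
proof -
  have "(\<lambda>t. indicator S t *\<^sub>R f t) = (\<lambda>t. indicator T t *\<^sub>R g t)"
    using assms by (auto simp: indicator_def fun_eq_iff)
  then show "(LINT t:S|lebesgue. f t) = (LINT t|lebesgue_on T. g t)"
    and "f absolutely_integrable_on S \<longleftrightarrow> integrable (lebesgue_on T) g"
    using S by (simp_all add: set_lebesgue_integral_def set_integrable_def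
        integral_restrict_space integrable_restrict_space)
qed

lemma left_RL_integral_eq:
  assumes \<gamma>: "0 < \<gamma>" and x: "x \<in> {a..b}"
  shows "left_RL_integral a \<gamma> f x = (LINT t|lebesgue_on {a..b}. left_kernel \<gamma> x t * f t)"
proof -
  have G: "Gamma \<gamma> > 0" using \<gamma> by (rule Gamma_real_pos)
  have "(LINT t:{a..x}|lebesgue. (x - t) powr (\<gamma> - 1) * f t) =
    (LINT t|lebesgue_on {a..b}. Gamma \<gamma> * (left_kernel \<gamma> x t * f t))"
    by (rule set_integral_eq_lebesgue_on) (use x G in \<open>auto simp: left_kernel_def rl_kernel_def\<close>)
  then show ?thesis using G by (simp add: left_RL_integral_def)
qed

lemma right_RL_integral_eq:
  assumes \<gamma>: "0 < \<gamma>" and x: "x \<in> {a..b}"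
  shows "right_RL_integral b \<gamma> f x = (LINT t|lebesgue_on {a..b}. right_kernel \<gamma> x t * f t)"
proof -
  have G: "Gamma \<gamma> > 0" using \<gamma> by (rule Gamma_real_pos)
  have "(LINT t:{x..b}|lebesgue. (t - x) powr (\<gamma> - 1) * f t) =
    (LINT t|lebesgue_on {a..b}. Gamma \<gamma> * (right_kernel \<gamma> x t * f t))"
    by (rule set_integral_eq_lebesgue_on) (use x G in \<open>auto simp: right_kernel_def rl_kernel_def\<close>)
  then show ?thesis using G by (simp add: right_RL_integral_def)
qed

lemma left_RL_integral_exists_iff:
  assumes \<gamma>: "0 < \<gamma>"
  shows "left_RL_integral_exists a b \<gamma> f \<longleftrightarrow>
    (\<forall>x\<in>{a..b}. integrable (lebesgue_on {a..b}) (\<lambda>t. left_kernel \<gamma> x t * f t))"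
proof -
  have G: "Gamma \<gamma> > 0" using \<gamma> by (rule Gamma_real_pos)
  have "(\<lambda>t. (x - t) powr (\<gamma> - 1) * f t) absolutely_integrable_on {a..x} \<longleftrightarrow>
      integrable (lebesgue_on {a..b}) (\<lambda>t. Gamma \<gamma> * (left_kernel \<gamma> x t * f t))" if "x \<in> {a..b}" for x
    by (rule set_integral_eq_lebesgue_on) (use that G in \<open>auto simp: left_kernel_def rl_kernel_def\<close>)
  then show ?thesis using G by (simp add: left_RL_integral_exists_def)
qed

text \<open>
  On \<open>[a,b]\<close> the kernel at the right end point \<open>b\<close> is bounded below by its value at distance
  \<open>b - a\<close>, so the existence of one fractional integral at \<open>b\<close> already implies integrability.
\<close>

lemma integrable_of_kernel_integrable:
  assumes \<gamma>: "0 < \<gamma>" "\<gamma> < 1" and ab: "a < b"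
    and i: "integrable (lebesgue_on {a..b}) (\<lambda>t. left_kernel \<gamma> b t * f t)"
  shows "integrable (lebesgue_on {a..b}) f"
proof -
  let ?c = "rl_kernel \<gamma> (b - a)"
  have c: "0 < ?c" using \<gamma> ab by (simp add: rl_kernel_def Gamma_real_pos)
  have pos: "AE t in lebesgue_on {a..b}. ?c \<le> left_kernel \<gamma> b t"
    using AE_lebesgue_on_neq[of b a b] AE_space
    by eventually_elim (use \<gamma> in \<open>auto simp: left_kernel_def intro!: rl_kernel_antimono\<close>)
  have [measurable]: "left_kernel \<gamma> b \<in> borel_measurable (lebesgue_on {a..b})"
    unfolding left_kernel_def[abs_def] by measurable
  have m: "(\<lambda>t. (left_kernel \<gamma> b t * f t) / left_kernel \<gamma> b t) \<in> borel_measurable (lebesgue_on {a..b})"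
    using i by measurable
  have eq: "AE t in lebesgue_on {a..b}. (left_kernel \<gamma> b t * f t) / left_kernel \<gamma> b t = f t"
    using pos by eventually_elim (use c in auto)
  have int: "integrable (lebesgue_on {a..b}) (\<lambda>t. (left_kernel \<gamma> b t * f t) / left_kernel \<gamma> b t)"
  proof (rule Bochner_Integration.integrable_bound[OF _ m])
    show "integrable (lebesgue_on {a..b}) (\<lambda>t. (1 / ?c) * (left_kernel \<gamma> b t * f t))"
      using i by simp
    show "AE t in lebesgue_on {a..b}. norm (left_kernel \<gamma> b t * f t / left_kernel \<gamma> b t)
        \<le> norm ((1 / ?c) * (left_kernel \<gamma> b t * f t))"
      using pos
    proof eventually_elim
      fix t assume le: "?c \<le> left_kernel \<gamma> b t"
      then have "?c * \<bar>f t\<bar> \<le> left_kernel \<gamma> b t * \<bar>f t\<bar>" by (intro mult_right_mono) auto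
      with le c show "norm (left_kernel \<gamma> b t * f t / left_kernel \<gamma> b t)
        \<le> norm ((1 / ?c) * (left_kernel \<gamma> b t * f t))"
        by (simp add: abs_mult field_simps)
    qed
  qed
  have f_meas: "f \<in> borel_measurable (lebesgue_on {a..b})"
  proof (subst measurable_cong)
    \<comment> \<open>The kernel vanishes at \<open>t = b\<close>, so this point is treated separately.\<close>
    show "f t = (if t = b then f b else (left_kernel \<gamma> b t * f t) / left_kernel \<gamma> b t)"
      if "t \<in> space (lebesgue_on {a..b})" for t
      using that rl_kernel_antimono[of \<gamma> "b - t" "b - a"] \<gamma> c by (auto simp: left_kernel_def)
    show "(\<lambda>t. if t = b then f b else (left_kernel \<gamma> b t * f t) / left_kernel \<gamma> b t)
        \<in> borel_measurable (lebesgue_on {a..b})"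
      using m by measurable
  qed
  from integrable_cong_AE_imp[OF int f_meas eq] show ?thesis .
qed

section \<open>Primitives of bounded derivatives\<close>

text \<open>
  The fundamental theorem of calculus gives Henstock-Kurzweil integrability of any derivative;
  boundedness makes the derivative Lebesgue integrable with the same integrals.
\<close>

lemma bounded_derivative_integrals:
  fixes G g :: "real \<Rightarrow> real"
  assumes deriv: "\<And>x. x \<in> {a..b} \<Longrightarrow> (G has_vector_derivative g x) (at x within {a..b})"
    and B: "\<And>x. x \<in> {a..b} \<Longrightarrow> \<bar>g x\<bar> \<le> B"
  shows "g \<in> borel_measurable (lebesgue_on {a..b})"
    and "x \<in> {a..b} \<Longrightarrow> (LINT t|lebesgue_on {a..b}. (if t < x then 1 else 0) * g t) = G x - G a"
    and "x \<in> {a..b} \<Longrightarrow> (LINT t|lebesgue_on {a..b}. (if x < t then 1 else 0) * g t) = G b - G x"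
proof -
  have hi: "(g has_integral G d - G c) {c..d}" if "a \<le> c" "c \<le> d" "d \<le> b" for c d
    by (rule fundamental_theorem_of_calculus[OF that(2)])
       (use that in \<open>auto intro!: has_vector_derivative_within_subset[OF deriv]\<close>)
  have meas: "g \<in> borel_measurable (lebesgue_on {c..d})" if "a \<le> c" "c \<le> d" "d \<le> b" for c d
    using hi[OF that] by (intro integrable_imp_measurable) auto
  have lint: "(LINT t:{c..d}|lebesgue. g t) = G d - G c" if "a \<le> c" "c \<le> d" "d \<le> b" for c d
  proof -
    have "g absolutely_integrable_on {c..d}"
      by (rule measurable_bounded_by_integrable_imp_absolutely_integrable[OF meas, where g = "\<lambda>_. B"])
         (use that B in auto)
    then show ?thesis
      using hi[OF that] by (simp add: set_lebesgue_integral_eq_integral integral_unique)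
  qed
  show m: "g \<in> borel_measurable (lebesgue_on {a..b})"
  proof (cases "a \<le> b")
    case False
    then show ?thesis by (simp add: measurable_def space_restrict_space)
  qed (use meas in auto)
  note [measurable] = m
  assume x: "x \<in> {a..b}"
  have "(LINT t|lebesgue_on {a..b}. (if t < x then 1 else 0) * g t) =
      (LINT t|lebesgue_on {a..b}. (if t \<le> x then 1 else 0) * g t)"
  proof (rule integral_cong_AE)
    show "AE t in lebesgue_on {a..b}. (if t < x then 1 else 0) * g t = (if t \<le> x then 1 else 0) * g t"
      using AE_lebesgue_on_neq[of x a b] by eventually_elim auto
  qed measurable
  also have "\<dots> = (LINT t:{a..x}|lebesgue. g t)"
    by (rule set_integral_eq_lebesgue_on[symmetric]) (use x in auto)
  finally show "(LINT t|lebesgue_on {a..b}. (if t < x then 1 else 0) * g t) = G x - G a"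
    using lint x by simp
  have "(LINT t|lebesgue_on {a..b}. (if x < t then 1 else 0) * g t) =
      (LINT t|lebesgue_on {a..b}. (if x \<le> t then 1 else 0) * g t)"
  proof (rule integral_cong_AE)
    show "AE t in lebesgue_on {a..b}. (if x < t then 1 else 0) * g t = (if x \<le> t then 1 else 0) * g t"
      using AE_lebesgue_on_neq[of x a b] by eventually_elim auto
  qed measurable
  also have "\<dots> = (LINT t:{x..b}|lebesgue. g t)"
    by (rule set_integral_eq_lebesgue_on[symmetric]) (use x in auto)
  finally show "(LINT t|lebesgue_on {a..b}. (if x < t then 1 else 0) * g t) = G b - G x"
    using lint x by simp
qed

lemma continuous_on_interval_bounded:
  fixes f :: "real \<Rightarrow> real"
  assumes "continuous_on {a..b} f"
  obtains B where "\<And>t. t \<in> {a..b} \<Longrightarrow> \<bar>f t\<bar> \<le> B"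
proof -
  have "bounded (f ` {a..b})"
    by (intro compact_imp_bounded compact_continuous_image assms compact_Icc)
  then show ?thesis using that by (fastforce simp: bounded_iff)
qed

lemma integral_continuous_has_vector_derivative:
  fixes v :: "real \<Rightarrow> real"
  assumes v: "continuous_on {a..b} v" and x: "x \<in> {a..b}"
  shows "((\<lambda>x. LINT t|lebesgue_on {a..b}. (if t < x then 1 else 0) * v t) has_vector_derivative v x)
    (at x within {a..b})"
proof -
  obtain B where B: "\<And>t. t \<in> {a..b} \<Longrightarrow> \<bar>v t\<bar> \<le> B"
    using continuous_on_interval_bounded[OF v] by blast
  have d: "((\<lambda>u. integral {a..u} v) has_vector_derivative v x) (at x within {a..b})"
    if "x \<in> {a..b}" for x
    by (rule integral_has_vector_derivative[OF v that])
  have "(LINT t|lebesgue_on {a..b}. (if t < u then 1 else 0) * v t) = integral {a..u} v"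
    if "u \<in> {a..b}" for u
    using bounded_derivative_integrals(2)[OF d B that] by simp
  then show ?thesis
    by (intro has_vector_derivative_transform[OF x _ d[OF x]]) auto
qed

section \<open>First variation of the functional\<close>

lemma continuous_on_strip_measurable:
  fixes g :: "real \<times> real \<times> real \<Rightarrow> 'b::topological_space"
  assumes g: "continuous_on ({a..b} \<times> UNIV \<times> UNIV) g"
    and P: "P \<in> borel_measurable (lebesgue_on {a..b})" and Q: "Q \<in> borel_measurable (lebesgue_on {a..b})"
  shows "(\<lambda>x. g (x, P x, Q x)) \<in> borel_measurable (lebesgue_on {a..b})"
proof (rule measurable_compose[OF measurable_restrict_space2 borel_measurable_continuous_on_restrict[OF g]])
  show "(\<lambda>x. (x, P x, Q x)) \<in> borel_measurable (lebesgue_on {a..b})"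
    using P Q by measurable
qed auto

lemma continuous_on_strip_bounded:
  fixes g :: "real \<times> real \<times> real \<Rightarrow> 'b::real_normed_vector"
  assumes g: "continuous_on ({a..b} \<times> UNIV \<times> UNIV) g"
  obtains K where "0 \<le> K" and "\<And>z. z \<in> {a..b} \<times> {- R..R} \<times> {- R..R} \<Longrightarrow> norm (g z) \<le> K"
proof -
  have "compact (g ` ({a..b} \<times> {- R..R} \<times> {- R..R}))"
    by (intro compact_continuous_image continuous_on_subset[OF g] compact_Times) auto
  then obtain K where "\<And>z. z \<in> {a..b} \<times> {- R..R} \<times> {- R..R} \<Longrightarrow> norm (g z) \<le> K"
    using compact_imp_bounded by (metis bounded_iff image_eqI)
  then have "\<And>z. z \<in> {a..b} \<times> {- R..R} \<times> {- R..R} \<Longrightarrow> norm (g z) \<le> max K 0" by force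
  then show ?thesis by (rule that[OF max.cobounded2])
qed

text \<open>
  The derivative of \<open>L\<close> is only taken within the strip \<open>[a,b] \<times> \<real> \<times> \<real>\<close>, which contains every line
  in a direction \<open>(0, c, d)\<close>; along such a line the derivative is therefore two-sided, even when
  \<open>x\<close> is an end point.
\<close>

lemma has_field_derivative_along_line:
  fixes L :: "real \<times> real \<times> real \<Rightarrow> real"
  assumes L: "\<And>z. z \<in> {a..b} \<times> UNIV \<times> UNIV \<Longrightarrow>
      (L has_derivative blinfun_apply (L' z)) (at z within {a..b} \<times> UNIV \<times> UNIV)"
    and x: "x \<in> {a..b}"
  shows "((\<lambda>e. L (x, p + e * c, q + e * d)) has_field_derivative
      blinfun_apply (L' (x, p + e\<^sub>0 * c, q + e\<^sub>0 * d)) (0, c, d)) (at e\<^sub>0)"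
proof -
  let ?g = "\<lambda>e. (x, p + e * c, q + e * d)"
  have g: "(?g has_derivative (\<lambda>e. (0, e * c, e * d))) (at e\<^sub>0)"
    by (auto intro!: derivative_eq_intros)
  have "(L has_derivative blinfun_apply (L' (?g e\<^sub>0))) (at (?g e\<^sub>0) within range ?g)"
    by (rule has_derivative_subset[OF L]) (use x in auto)
  from diff_chain_within[OF g this]
  have "((\<lambda>e. L (?g e)) has_derivative (\<lambda>e. blinfun_apply (L' (?g e\<^sub>0)) (0, e * c, e * d))) (at e\<^sub>0)"
    by (simp add: o_def)
  moreover have "blinfun_apply (L' (?g e\<^sub>0)) (0, e * c, e * d) = blinfun_apply (L' (?g e\<^sub>0)) (0, c, d) * e" for e
    using blinfun.scaleR_right[of "L' (?g e\<^sub>0)" e "(0, c, d)"] by (simp add: mult.commute)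
  ultimately show ?thesis by (simp add: has_field_derivative_def)
qed

lemma partials_eq_derivative:
  fixes L :: "real \<times> real \<times> real \<Rightarrow> real"
  assumes L: "\<And>z. z \<in> {a..b} \<times> UNIV \<times> UNIV \<Longrightarrow>
      (L has_derivative blinfun_apply (L' z)) (at z within {a..b} \<times> UNIV \<times> UNIV)"
    and x: "x \<in> {a..b}"
  shows "partial2 L (x, p, q) = blinfun_apply (L' (x, p, q)) (0, 1, 0)"
    and "partial3 L (x, p, q) = blinfun_apply (L' (x, p, q)) (0, 0, 1)"
    and "blinfun_apply (L' (x, p, q)) (0, c, d) = partial2 L (x, p, q) * c + partial3 L (x, p, q) * d"
proof -
  show 2: "partial2 L (x, p, q) = blinfun_apply (L' (x, p, q)) (0, 1, 0)"
    using has_field_derivative_along_line[OF L x, of 0 1 q 0 p] by (simp add: partial2_def DERIV_imp_deriv)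
  show 3: "partial3 L (x, p, q) = blinfun_apply (L' (x, p, q)) (0, 0, 1)"
    using has_field_derivative_along_line[OF L x, of p 0 0 1 q] by (simp add: partial3_def DERIV_imp_deriv)
  have "(0, c, d) = c *\<^sub>R (0, 1, 0) + d *\<^sub>R (0 :: real, 0 :: real, 1 :: real)" by simp
  then show "blinfun_apply (L' (x, p, q)) (0, c, d) = partial2 L (x, p, q) * c + partial3 L (x, p, q) * d"
    unfolding 2 3 by (simp only: blinfun.add_right blinfun.scaleR_right) simp
qed

text \<open>
  Along \<open>\<epsilon> = 1 / (n + 1)\<close> the difference quotients of the integrand converge pointwise to the
  integrand of the first variation. By the mean value inequality they are bounded uniformly, because
  for \<open>\<epsilon> \<le> 1\<close> all arguments stay in a compact convex box on which the derivative of \<open>L\<close> is bounded.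
  Their integrals are eventually nonnegative by minimality.
\<close>

lemma first_variation_nonneg:
  fixes L :: "real \<times> real \<times> real \<Rightarrow> real"
  assumes L: "\<And>z. z \<in> {a..b} \<times> UNIV \<times> UNIV \<Longrightarrow>
      (L has_derivative blinfun_apply (L' z)) (at z within {a..b} \<times> UNIV \<times> UNIV)"
    and L': "continuous_on ({a..b} \<times> UNIV \<times> UNIV) L'"
    and meas: "P \<in> borel_measurable (lebesgue_on {a..b})" "V \<in> borel_measurable (lebesgue_on {a..b})"
      "p \<in> borel_measurable (lebesgue_on {a..b})" "v \<in> borel_measurable (lebesgue_on {a..b})"
    and bounds: "\<And>x. x \<in> {a..b} \<Longrightarrow> \<bar>P x\<bar> \<le> B" "\<And>x. x \<in> {a..b} \<Longrightarrow> \<bar>V x\<bar> \<le> B"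
      "\<And>x. x \<in> {a..b} \<Longrightarrow> \<bar>p x\<bar> \<le> B" "\<And>x. x \<in> {a..b} \<Longrightarrow> \<bar>v x\<bar> \<le> B"
    and min: "\<forall>\<^sub>F e in nhds 0. (LINT x|lebesgue_on {a..b}. L (x, P x, V x)) \<le>
      (LINT x|lebesgue_on {a..b}. L (x, P x + e * p x, V x + e * v x))"
  shows "0 \<le> (LINT x|lebesgue_on {a..b}. partial2 L (x, P x, V x) * p x + partial3 L (x, P x, V x) * v x)"
proof -
  let ?M = "lebesgue_on {a..b}" and ?S = "{a..b} \<times> (UNIV :: real set) \<times> (UNIV :: real set)"
  let ?C = "{a..b} \<times> {- (2 * B)..2 * B} \<times> {- (2 * B)..2 * B}"
  note [measurable] = meas
  interpret finite_measure ?M by (rule finite_measure_lebesgue_on) simp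
  have Lc: "continuous_on ?S L"
    using L by (meson has_derivative_continuous_on)
  obtain K where K: "0 \<le> K" "\<And>z. z \<in> ?C \<Longrightarrow> norm (L' z) \<le> K"
    using continuous_on_strip_bounded[OF L'] by blast
  obtain K0 where K0: "0 \<le> K0" "\<And>z. z \<in> ?C \<Longrightarrow> norm (L z) \<le> K0"
    using continuous_on_strip_bounded[OF Lc] by blast
  \<comment> \<open>Both summands of each argument are at most \<open>B\<close> in absolute value, whence the box of radius \<open>2 * B\<close>.\<close>
  have in_C: "(x, P x + e * p x, V x + e * v x) \<in> ?C" if "x \<in> {a..b}" "0 \<le> e" "e \<le> 1" for x e
  proof -
    have "\<bar>e * p x\<bar> \<le> 1 * B" "\<bar>e * v x\<bar> \<le> 1 * B"
      using bounds[OF that(1)] that unfolding abs_mult by (intro mult_mono; simp)+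
    with bounds[OF that(1)] that(1) show ?thesis by auto
  qed
  have Lm: "(\<lambda>x. L (x, P x + e * p x, V x + e * v x)) \<in> borel_measurable ?M" for e
    by (rule continuous_on_strip_measurable[OF Lc]) measurable
  have Li: "integrable ?M (\<lambda>x. L (x, P x + e * p x, V x + e * v x))" if "0 \<le> e" "e \<le> 1" for e
    by (rule integrable_const_bound[OF _ Lm, where B = K0]) (use K0(2)[OF in_C] that in \<open>auto intro!: AE_I2\<close>)
  define \<epsilon> where "\<epsilon> n = 1 / real (Suc n)" for n
  have \<epsilon>: "0 < \<epsilon> n" "\<epsilon> n \<le> 1" for n by (auto simp: \<epsilon>_def)
  have \<epsilon>_lim: "\<epsilon> \<longlonglongrightarrow> 0" unfolding \<epsilon>_def by (rule LIMSEQ_Suc[OF lim_1_over_n])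
  define D where "D n x = (L (x, P x + \<epsilon> n * p x, V x + \<epsilon> n * v x) - L (x, P x, V x)) / \<epsilon> n" for n x
  have Dm: "D n \<in> borel_measurable ?M" for n
    unfolding D_def[abs_def] using Lm[of "\<epsilon> n"] Lm[of 0] by simp
  have D_lim: "(\<lambda>n. D n x) \<longlonglongrightarrow> partial2 L (x, P x, V x) * p x + partial3 L (x, P x, V x) * v x"
    if x: "x \<in> {a..b}" for x
  proof -
    have "((\<lambda>e. L (x, P x + e * p x, V x + e * v x)) has_field_derivative
        partial2 L (x, P x, V x) * p x + partial3 L (x, P x, V x) * v x) (at 0)"
      using has_field_derivative_along_line[OF L x, of "P x" "p x" "V x" "v x" 0]
        partials_eq_derivative(3)[OF L x] by simp
    then have "((\<lambda>e. (L (x, P x + e * p x, V x + e * v x) - L (x, P x, V x)) / e) \<longlongrightarrow>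
        partial2 L (x, P x, V x) * p x + partial3 L (x, P x, V x) * v x) (at 0)"
      by (simp add: has_field_derivative_iff)
    moreover have "filterlim \<epsilon> (at 0) sequentially"
      using \<epsilon>_lim \<epsilon>(1) by (auto simp: filterlim_at intro!: always_eventually) (metis less_irrefl)
    ultimately show ?thesis unfolding D_def by (rule filterlim_compose)
  qed
  have D_bound: "norm (D n x) \<le> K * (2 * B)" if x: "x \<in> {a..b}" for n x
  proof -
    have "norm (L (x, P x + \<epsilon> n * p x, V x + \<epsilon> n * v x) - L (x, P x, V x)) \<le>
      K * norm ((x, P x + \<epsilon> n * p x, V x + \<epsilon> n * v x) - (x, P x, V x))"
    proof (rule differentiable_bound[where S = ?C and f' = "\<lambda>z. blinfun_apply (L' z)"])
      show "convex ?C" by (intro convex_Times convex_real_interval)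
      show "(L has_derivative blinfun_apply (L' z)) (at z within ?C)" if "z \<in> ?C" for z
        by (rule has_derivative_subset[OF L]) (use that in auto)
      show "onorm (blinfun_apply (L' z)) \<le> K" if "z \<in> ?C" for z
        using K(2)[OF that] by (simp add: norm_blinfun.rep_eq)
      show "(x, P x + \<epsilon> n * p x, V x + \<epsilon> n * v x) \<in> ?C" by (intro in_C x less_imp_le[OF \<epsilon>(1)] \<epsilon>(2))
      show "(x, P x, V x) \<in> ?C" using in_C[OF x, of 0] by simp
    qed
    also have "(x, P x + \<epsilon> n * p x, V x + \<epsilon> n * v x) - (x, P x, V x) = \<epsilon> n *\<^sub>R (0, p x, v x)"
      by simp
    also have "norm (\<epsilon> n *\<^sub>R (0 :: real, p x, v x)) \<le> \<epsilon> n * (2 * B)"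
    proof -
      have "norm (0 :: real, p x, v x) \<le> \<bar>p x\<bar> + \<bar>v x\<bar>"
        using norm_Pair_le[of "p x" "v x"] by (simp add: norm_Pair)
      with bounds[OF x] have "norm (0 :: real, p x, v x) \<le> 2 * B" by simp
      with \<epsilon>(1)[of n] show ?thesis by (simp only: norm_scaleR abs_of_pos mult_left_mono less_imp_le)
    qed
    finally have "norm (L (x, P x + \<epsilon> n * p x, V x + \<epsilon> n * v x) - L (x, P x, V x)) \<le> K * (\<epsilon> n * (2 * B))"
      by (simp add: mult_left_mono K(1))
    then show ?thesis
      using \<epsilon>(1)[of n] by (simp add: D_def field_simps)
  qed
  have "(\<lambda>n. LINT x|?M. D n x) \<longlonglongrightarrow>
      (LINT x|?M. partial2 L (x, P x, V x) * p x + partial3 L (x, P x, V x) * v x)"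
  proof (rule integral_dominated_convergence[where w = "\<lambda>_. K * (2 * B)"])
    show "(\<lambda>x. partial2 L (x, P x, V x) * p x + partial3 L (x, P x, V x) * v x) \<in> borel_measurable ?M"
      by (rule borel_measurable_LIMSEQ_metric[where f = D, OF Dm]) (use D_lim in auto)
  qed (use Dm D_lim D_bound in \<open>auto intro!: AE_I2\<close>)
  moreover have "\<forall>\<^sub>F n in sequentially. 0 \<le> (LINT x|?M. D n x)"
  proof -
    have "\<forall>\<^sub>F n in sequentially. (LINT x|?M. L (x, P x, V x)) \<le>
      (LINT x|?M. L (x, P x + \<epsilon> n * p x, V x + \<epsilon> n * v x))"
      using min \<epsilon>_lim by (rule eventually_compose_filterlim)
    then show ?thesis
    proof eventually_elim
      case (elim n)
      have "(LINT x|?M. D n x) = ((LINT x|?M. L (x, P x + \<epsilon> n * p x, V x + \<epsilon> n * v x)) -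
          (LINT x|?M. L (x, P x, V x))) / \<epsilon> n"
        unfolding D_def using Li[of "\<epsilon> n"] Li[of 0] \<epsilon>[of n] by simp
      with elim \<epsilon>(1)[of n] show ?case by simp
    qed
  qed
  ultimately show ?thesis
    by (rule tendsto_lowerbound) simp
qed

section \<open>Admissible variations\<close>

text \<open>
  The variation \<open>\<eta> = I\<^sup>\<beta> v\<close> satisfies \<open>I\<^sup>1\<^sup>-\<^sup>\<beta> \<eta> = I\<^sup>1 v\<close> at every point, so its derivative of order \<open>\<beta>\<close>
  exists everywhere on \<open>[a,b]\<close> and equals the continuous function \<open>v\<close>.
\<close>

lemma variation_by_fractional_integral:
  fixes v \<eta> :: "real \<Rightarrow> real"
  assumes ab: "a < b" and \<alpha>: "0 < \<alpha>" "\<alpha> < 1" and \<beta>: "0 < \<beta>" "\<beta> < 1"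
    and v: "continuous_on {a..b} v"
    and \<eta>_def: "\<eta> = (\<lambda>x. LINT t|lebesgue_on {a..b}. left_kernel \<beta> x t * v t)"
  obtains B where "\<eta> \<in> borel_measurable (lebesgue_on {a..b})" and "v \<in> borel_measurable (lebesgue_on {a..b})"
    and "\<And>x. x \<in> {a..b} \<Longrightarrow> \<bar>\<eta> x\<bar> \<le> B" and "\<And>x. x \<in> {a..b} \<Longrightarrow> \<bar>v x\<bar> \<le> B"
    and "\<And>x. x \<in> {a..b} \<Longrightarrow> \<bar>left_RL_integral a (1 - \<alpha>) \<eta> x\<bar> \<le> B"
    and "(\<lambda>x. left_RL_integral a (1 - \<alpha>) \<eta> x) \<in> borel_measurable (lebesgue_on {a..b})"
    and "left_RL_integral_exists a b (1 - \<alpha>) \<eta>"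
    and "left_RL_integral_exists a b (1 - \<beta>) \<eta>"
    and "\<And>x. x \<in> {a..b} \<Longrightarrow>
      (left_RL_integral a (1 - \<beta>) \<eta> has_vector_derivative v x) (at x within {a..b})"
proof -
  let ?M = "lebesgue_on {a..b}"
  interpret A: abel_pair a b "left_kernel \<beta>" "left_kernel (1 - \<beta>)"
    "1 / rl_kernel (1 - \<beta>) (b - a)" "1 / rl_kernel \<beta> (b - a)" "\<lambda>x t. if t < x then 1 else 0"
    by (rule abel_pair_left[OF \<beta> ab])
  interpret I: bounded_kernel ?M "left_kernel (1 - \<alpha>)" "1 / rl_kernel \<alpha> (b - a)"
    using bounded_kernel_left[of "1 - \<alpha>" a b] \<alpha> ab by simp
  obtain B0 where "\<And>t. t \<in> {a..b} \<Longrightarrow> \<bar>v t\<bar> \<le> B0"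
    using continuous_on_interval_bounded[OF v] by blast
  then have vb: "\<bar>v t\<bar> \<le> \<bar>B0\<bar>" if "t \<in> {a..b}" for t using that by fastforce
  have vm: "v \<in> borel_measurable ?M"
    by (intro continuous_imp_measurable_on_sets_lebesgue v) auto
  have vAE: "AE t in ?M. \<bar>v t\<bar> \<le> \<bar>B0\<bar>" using vb by (intro AE_I2) auto
  have vi: "integrable ?M v"
    by (rule A.K.integrable_const_bound[OF _ vm, where B = "\<bar>B0\<bar>"]) (use vAE in simp)
  define B1 where "B1 = \<bar>B0\<bar> * (1 / rl_kernel (1 - \<beta>) (b - a))"
  have \<eta>m: "\<eta> \<in> borel_measurable ?M"
    unfolding \<eta>_def by (rule A.K.measurable_kernel_integral[OF vm])
  have \<eta>b: "\<bar>\<eta> x\<bar> \<le> B1" if "x \<in> {a..b}" for x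
    unfolding \<eta>_def B1_def by (rule A.K.abs_kernel_integral_le[OF vm vAE]) (use that in auto)
  then have \<eta>AE: "AE t in ?M. \<bar>\<eta> t\<bar> \<le> B1" by (intro AE_I2) auto
  have "0 \<le> B1" using \<eta>b[of a] ab by force
  define B2 where "B2 = B1 * (1 / rl_kernel \<alpha> (b - a))"
  have p_eq: "left_RL_integral a (1 - \<alpha>) \<eta> x = (LINT t|?M. left_kernel (1 - \<alpha>) x t * \<eta> t)"
    if "x \<in> {a..b}" for x
    by (rule left_RL_integral_eq) (use \<alpha> that in auto)
  have pb: "\<bar>left_RL_integral a (1 - \<alpha>) \<eta> x\<bar> \<le> B2" if "x \<in> {a..b}" for x
    unfolding p_eq[OF that] B2_def
    by (rule I.abs_kernel_integral_le[OF \<eta>m \<eta>AE]) (use that \<open>0 \<le> B1\<close> in auto)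
  have pm: "(\<lambda>x. left_RL_integral a (1 - \<alpha>) \<eta> x) \<in> borel_measurable ?M"
    by (subst measurable_cong[OF p_eq]) (auto intro: I.measurable_kernel_integral[OF \<eta>m])
  have "left_RL_integral a (1 - \<beta>) \<eta> x = (LINT t|?M. (if t < x then 1 else 0) * v t)"
    if "x \<in> {a..b}" for x
    using left_RL_integral_eq[of "1 - \<beta>" x a b \<eta>] A.compose_HK[OF vi that] \<beta> that
    by (simp add: \<eta>_def)
  then have d: "(left_RL_integral a (1 - \<beta>) \<eta> has_vector_derivative v x) (at x within {a..b})"
    if "x \<in> {a..b}" for x
    by (rule has_vector_derivative_transform[OF that _ integral_continuous_has_vector_derivative[OF v that]])
  show ?thesis
  proof (rule that[of "\<bar>B0\<bar> + \<bar>B1\<bar> + \<bar>B2\<bar>"])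
    show "left_RL_integral_exists a b (1 - \<alpha>) \<eta>"
      using \<alpha> I.integrable_kernel_mult[OF \<eta>m \<eta>AE] by (simp add: left_RL_integral_exists_iff)
    show "left_RL_integral_exists a b (1 - \<beta>) \<eta>"
      using \<beta> A.H.integrable_kernel_mult[OF \<eta>m \<eta>AE] by (simp add: left_RL_integral_exists_iff)
    show "\<bar>\<eta> x\<bar> \<le> \<bar>B0\<bar> + \<bar>B1\<bar> + \<bar>B2\<bar>" if "x \<in> {a..b}" for x
      using \<eta>b[OF that] by linarith
    show "\<bar>v x\<bar> \<le> \<bar>B0\<bar> + \<bar>B1\<bar> + \<bar>B2\<bar>" if "x \<in> {a..b}" for x
      using vb[OF that] by linarith
    show "\<bar>left_RL_integral a (1 - \<alpha>) \<eta> x\<bar> \<le> \<bar>B0\<bar> + \<bar>B1\<bar> + \<bar>B2\<bar>" if "x \<in> {a..b}" for x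
      using pb[OF that] by linarith
  qed (use \<eta>m vm pm d in auto)
qed

lemma left_RL_integral_add_scale:
  assumes "0 < \<gamma>" "x \<in> {a..b}"
    and "left_RL_integral_exists a b \<gamma> f" "left_RL_integral_exists a b \<gamma> g"
  shows "left_RL_integral a \<gamma> (\<lambda>x. f x + c * g x) x = left_RL_integral a \<gamma> f x + c * left_RL_integral a \<gamma> g x"
proof -
  have "integrable (lebesgue_on {a..b}) (\<lambda>t. left_kernel \<gamma> x t * f t)"
    "integrable (lebesgue_on {a..b}) (\<lambda>t. left_kernel \<gamma> x t * g t)"
    using assms by (simp_all add: left_RL_integral_exists_iff)
  then show ?thesis
    unfolding left_RL_integral_eq[OF assms(1,2)] by (simp add: distrib_left mult.left_commute)
qed

lemma left_RL_integral_exists_add_scale: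
  assumes "0 < \<gamma>" "left_RL_integral_exists a b \<gamma> f" "left_RL_integral_exists a b \<gamma> g"
  shows "left_RL_integral_exists a b \<gamma> (\<lambda>x. f x + c * g x)"
  using assms by (simp add: left_RL_integral_exists_iff distrib_left mult.left_commute)

text \<open>
  The fractional integral of order \<open>1 - \<beta>\<close> of \<open>y\<close> has the bounded derivative \<open>V\<close> and vanishes at
  \<open>a\<close>, so it is the primitive of \<open>V\<close>. Abel inversion represents \<open>y\<close> almost everywhere as \<open>I\<^sup>\<beta> V\<close>;
  thus \<open>y\<close> is essentially bounded, and so is each of its fractional integrals.
\<close>

lemma frac_arg_bounded:
  assumes ab: "a < b" and \<alpha>: "0 < \<alpha>" "\<alpha> < 1" and \<beta>: "0 < \<beta>" "\<beta> < 1"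
    and ey: "left_RL_integral_exists a b (1 - \<alpha>) y"
    and dy: "left_RL_deriv_exists a b \<beta> y"
    and bd: "bounded (left_RL_deriv a b \<beta> y ` {a..b})"
  obtains B where "left_RL_integral a (1 - \<alpha>) y \<in> borel_measurable (lebesgue_on {a..b})"
    and "left_RL_deriv a b \<beta> y \<in> borel_measurable (lebesgue_on {a..b})"
    and "\<And>x. x \<in> {a..b} \<Longrightarrow> \<bar>left_RL_integral a (1 - \<alpha>) y x\<bar> \<le> B"
    and "\<And>x. x \<in> {a..b} \<Longrightarrow> \<bar>left_RL_deriv a b \<beta> y x\<bar> \<le> B"
proof -
  let ?M = "lebesgue_on {a..b}" and ?V = "left_RL_deriv a b \<beta> y"
  interpret A: abel_pair a b "left_kernel \<beta>" "left_kernel (1 - \<beta>)"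
    "1 / rl_kernel (1 - \<beta>) (b - a)" "1 / rl_kernel \<beta> (b - a)" "\<lambda>x t. if t < x then 1 else 0"
    by (rule abel_pair_left[OF \<beta> ab])
  interpret I: bounded_kernel ?M "left_kernel (1 - \<alpha>)" "1 / rl_kernel \<alpha> (b - a)"
    using bounded_kernel_left[of "1 - \<alpha>" a b] \<alpha> ab by simp
  obtain B0 where "\<And>x. x \<in> {a..b} \<Longrightarrow> \<bar>?V x\<bar> \<le> B0"
    using bd by (fastforce simp: bounded_iff)
  then have Vb: "\<bar>?V x\<bar> \<le> \<bar>B0\<bar>" if "x \<in> {a..b}" for x using that by fastforce
  have gd: "(left_RL_integral a (1 - \<beta>) y has_vector_derivative ?V x) (at x within {a..b})"
    if "x \<in> {a..b}" for x
    using dy that by (auto simp: left_RL_deriv_exists_def left_RL_deriv_def vector_derivative_works)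
  have V: "?V \<in> borel_measurable ?M"
    by (rule bounded_derivative_integrals(1)[OF gd Vb])
  have VAE: "AE x in ?M. \<bar>?V x\<bar> \<le> \<bar>B0\<bar>" using Vb by (intro AE_I2) auto
  have ei: "integrable ?M (\<lambda>t. left_kernel (1 - \<beta>) x t * y t)" if "x \<in> {a..b}" for x
    using dy that \<beta> by (simp add: left_RL_deriv_exists_def left_RL_integral_exists_iff)
  have yi: "integrable ?M y"
    by (rule integrable_of_kernel_integrable[OF _ _ ab ei]) (use \<beta> ab in auto)
  have g0: "left_RL_integral a (1 - \<beta>) y a = 0"
  proof -
    have "(\<lambda>t. indicator {a..a} t *\<^sub>R ((a - t) powr (1 - \<beta> - 1) * y t)) = (\<lambda>t. 0)"
      by (auto simp: indicator_def)
    then show ?thesis by (simp add: left_RL_integral_def set_lebesgue_integral_def)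
  qed
  have y_eq: "AE x in ?M. y x = (LINT t|?M. left_kernel \<beta> x t * ?V t)"
  proof (rule A.abel_inversion[OF yi V VAE])
    show "(LINT t|?M. left_kernel (1 - \<beta>) x t * y t) = (LINT t|?M. (if t < x then 1 else 0) * ?V t)"
      if "x \<in> {a..b}" for x
      using bounded_derivative_integrals(2)[OF gd Vb that] g0 left_RL_integral_eq[of "1 - \<beta>" x a b y] \<beta> that by simp
  qed simp
  define B1 where "B1 = \<bar>B0\<bar> * (1 / rl_kernel (1 - \<beta>) (b - a))"
  have kb: "\<bar>LINT t|?M. left_kernel \<beta> x t * ?V t\<bar> \<le> B1" if "x \<in> {a..b}" for x
    unfolding B1_def by (rule A.K.abs_kernel_integral_le[OF V VAE]) (use that in auto)
  have "0 \<le> B1" using kb[of a] ab by force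
  have yAE: "AE x in ?M. \<bar>y x\<bar> \<le> B1"
    using y_eq AE_space by eventually_elim (use kb in auto)
  have ym: "y \<in> borel_measurable ?M" using yi by auto
  define B2 where "B2 = B1 * (1 / rl_kernel \<alpha> (b - a))"
  have P_eq: "left_RL_integral a (1 - \<alpha>) y x = (LINT t|?M. left_kernel (1 - \<alpha>) x t * y t)"
    if "x \<in> {a..b}" for x
    by (rule left_RL_integral_eq) (use \<alpha> that in auto)
  have Pb: "\<bar>left_RL_integral a (1 - \<alpha>) y x\<bar> \<le> B2" if "x \<in> {a..b}" for x
    unfolding P_eq[OF that] B2_def
    by (rule I.abs_kernel_integral_le[OF ym yAE]) (use that \<open>0 \<le> B1\<close> in auto)
  have Pm: "left_RL_integral a (1 - \<alpha>) y \<in> borel_measurable ?M"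
    by (subst measurable_cong[OF P_eq]) (auto intro: I.measurable_kernel_integral[OF ym])
  show ?thesis
  proof (rule that[of "\<bar>B0\<bar> + \<bar>B2\<bar>"])
    show "\<bar>left_RL_integral a (1 - \<alpha>) y x\<bar> \<le> \<bar>B0\<bar> + \<bar>B2\<bar>" if "x \<in> {a..b}" for x
      using Pb[OF that] by linarith
    show "\<bar>?V x\<bar> \<le> \<bar>B0\<bar> + \<bar>B2\<bar>" if "x \<in> {a..b}" for x
      using Vb[OF that] by linarith
  qed (use Pm V in auto)
qed

text \<open>
  By linearity the arguments of \<open>L\<close> for \<open>y + \<epsilon> \<eta>\<close> are exactly those for \<open>y\<close> plus \<open>\<epsilon>\<close> times
  \<open>(0, I\<^sup>1\<^sup>-\<^sup>\<alpha> \<eta>, v)\<close>. All of them are bounded, so \<open>y + \<epsilon> \<eta>\<close> is admissible for every \<open>\<epsilon>\<close>.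
\<close>

lemma local_minimizer_first_variation:
  fixes L :: "real \<times> real \<times> real \<Rightarrow> real" and v \<eta> :: "real \<Rightarrow> real"
  assumes ab: "a < b" and \<alpha>: "0 < \<alpha>" "\<alpha> < 1" and \<beta>: "0 < \<beta>" "\<beta> < 1"
    and L: "\<And>z. z \<in> {a..b} \<times> UNIV \<times> UNIV \<Longrightarrow>
      (L has_derivative blinfun_apply (L' z)) (at z within {a..b} \<times> UNIV \<times> UNIV)"
    and L': "continuous_on ({a..b} \<times> UNIV \<times> UNIV) L'"
    and bd: "bounded (left_RL_deriv a b \<beta> y ` {a..b})"
    and min: "local_minimizer a b \<alpha> \<beta> L y"
    and v: "continuous_on {a..b} v"
    and \<eta>_def: "\<eta> = (\<lambda>x. LINT t|lebesgue_on {a..b}. left_kernel \<beta> x t * v t)"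
  shows "0 \<le> (LINT x|lebesgue_on {a..b}. partial2 L (frac_arg a b \<alpha> \<beta> y x) * left_RL_integral a (1 - \<alpha>) \<eta> x
      + partial3 L (frac_arg a b \<alpha> \<beta> y x) * v x)"
proof -
  let ?M = "lebesgue_on {a..b}"
  let ?P = "left_RL_integral a (1 - \<alpha>) y" and ?V = "left_RL_deriv a b \<beta> y"
  let ?p = "left_RL_integral a (1 - \<alpha>) \<eta>"
  have adm: "left_RL_integral_exists a b (1 - \<alpha>) y" "left_RL_deriv_exists a b \<beta> y"
    using min by (auto simp: local_minimizer_def admissible_def)
  obtain B1 where \<eta>: "v \<in> borel_measurable ?M" "\<And>x. x \<in> {a..b} \<Longrightarrow> \<bar>v x\<bar> \<le> B1"
      "\<And>x. x \<in> {a..b} \<Longrightarrow> \<bar>?p x\<bar> \<le> B1" "?p \<in> borel_measurable ?M"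
      "left_RL_integral_exists a b (1 - \<alpha>) \<eta>" "left_RL_integral_exists a b (1 - \<beta>) \<eta>"
      "\<And>x. x \<in> {a..b} \<Longrightarrow> (left_RL_integral a (1 - \<beta>) \<eta> has_vector_derivative v x) (at x within {a..b})"
    by (rule variation_by_fractional_integral[OF ab \<alpha> \<beta> v \<eta>_def]) (rule that; assumption)
  obtain B2 where y: "?P \<in> borel_measurable ?M" "?V \<in> borel_measurable ?M"
      "\<And>x. x \<in> {a..b} \<Longrightarrow> \<bar>?P x\<bar> \<le> B2" "\<And>x. x \<in> {a..b} \<Longrightarrow> \<bar>?V x\<bar> \<le> B2"
    by (rule frac_arg_bounded[OF ab \<alpha> \<beta> adm bd]) (rule that; assumption)
  have gd: "(left_RL_integral a (1 - \<beta>) y has_vector_derivative ?V x) (at x within {a..b})"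
    if "x \<in> {a..b}" for x
    using adm(2) that by (auto simp: left_RL_deriv_exists_def left_RL_deriv_def vector_derivative_works)
  have ey: "left_RL_integral_exists a b (1 - \<beta>) y" using adm(2) by (simp add: left_RL_deriv_exists_def)
  have gde: "(left_RL_integral a (1 - \<beta>) (\<lambda>x. y x + e * \<eta> x) has_vector_derivative ?V x + e * v x)
      (at x within {a..b})" if x: "x \<in> {a..b}" for x e
  proof (rule has_vector_derivative_transform[OF x])
    show "left_RL_integral a (1 - \<beta>) (\<lambda>x. y x + e * \<eta> x) u =
        left_RL_integral a (1 - \<beta>) y u + e * left_RL_integral a (1 - \<beta>) \<eta> u" if "u \<in> {a..b}" for u
      by (rule left_RL_integral_add_scale[OF _ that ey \<eta>(6)]) (use \<beta> in simp)
    show "((\<lambda>u. left_RL_integral a (1 - \<beta>) y u + e * left_RL_integral a (1 - \<beta>) \<eta> u)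
        has_vector_derivative ?V x + e * v x) (at x within {a..b})"
      by (intro has_vector_derivative_add has_vector_derivative_mult_right gd \<eta>(7) x)
  qed
  have arg: "frac_arg a b \<alpha> \<beta> (\<lambda>x. y x + e * \<eta> x) x = (x, ?P x + e * ?p x, ?V x + e * v x)"
    if x: "x \<in> {a..b}" for x e
    using left_RL_integral_add_scale[OF _ x adm(1) \<eta>(5), of e] \<alpha>
      vector_derivative_within_closed_interval[OF ab x gde[OF x, of e]]
    by (simp add: frac_arg_def left_RL_deriv_def)
  have Lc: "continuous_on ({a..b} \<times> UNIV \<times> UNIV) L"
    using L by (meson has_derivative_continuous_on)
  interpret finite_measure ?M by (rule finite_measure_lebesgue_on) simp
  have Li: "integrable ?M (\<lambda>x. L (x, ?P x + e * ?p x, ?V x + e * v x))" for e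
  proof -
    obtain K where K: "\<And>z. z \<in> {a..b} \<times> {- (B2 + \<bar>e\<bar> * B1)..B2 + \<bar>e\<bar> * B1} \<times>
        {- (B2 + \<bar>e\<bar> * B1)..B2 + \<bar>e\<bar> * B1} \<Longrightarrow> norm (L z) \<le> K"
      using continuous_on_strip_bounded[OF Lc] by blast
    have m: "(\<lambda>x. L (x, ?P x + e * ?p x, ?V x + e * v x)) \<in> borel_measurable ?M"
      by (rule continuous_on_strip_measurable[OF Lc]) (use y \<eta> in measurable)
    have le: "norm (L (x, ?P x + e * ?p x, ?V x + e * v x)) \<le> K" if x: "x \<in> {a..b}" for x
    proof (rule K)
      have "\<bar>e * ?p x\<bar> \<le> \<bar>e\<bar> * B1" "\<bar>e * v x\<bar> \<le> \<bar>e\<bar> * B1"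
        using \<eta>(2,3)[OF x] unfolding abs_mult by (simp_all add: mult_left_mono)
      with y(3,4)[OF x] x show "(x, ?P x + e * ?p x, ?V x + e * v x) \<in>
          {a..b} \<times> {- (B2 + \<bar>e\<bar> * B1)..B2 + \<bar>e\<bar> * B1} \<times> {- (B2 + \<bar>e\<bar> * B1)..B2 + \<bar>e\<bar> * B1}"
        unfolding abs_le_iff by auto
    qed
    show ?thesis
      by (rule integrable_const_bound[OF _ m, where B = K]) (use le in \<open>auto intro: AE_I2\<close>)
  qed
  have J: "(\<lambda>x. L (frac_arg a b \<alpha> \<beta> (\<lambda>x. y x + e * \<eta> x) x)) absolutely_integrable_on {a..b}"
      "frac_functional a b \<alpha> \<beta> L (\<lambda>x. y x + e * \<eta> x) =
        (LINT x|?M. L (x, ?P x + e * ?p x, ?V x + e * v x))" for e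
    using set_integral_eq_lebesgue_on[of "{a..b}" "{a..b}" "\<lambda>x. L (frac_arg a b \<alpha> \<beta> (\<lambda>x. y x + e * \<eta> x) x)"
        "\<lambda>x. L (x, ?P x + e * ?p x, ?V x + e * v x)"] arg Li[of e]
    by (auto simp: frac_functional_def)
  have "admissible a b \<alpha> \<beta> L (\<lambda>x. y x + e * \<eta> x)" for e
    unfolding admissible_def left_RL_deriv_exists_def
    using J(1) left_RL_integral_exists_add_scale[OF _ adm(1) \<eta>(5)]
      left_RL_integral_exists_add_scale[OF _ ey \<eta>(6)] differentiableI_vector[OF gde] \<alpha> \<beta>
    by auto
  then have "\<forall>\<^sub>F e in nhds 0. frac_functional a b \<alpha> \<beta> L y \<le> frac_functional a b \<alpha> \<beta> L (\<lambda>x. y x + e * \<eta> x)"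
    using min by (simp add: local_minimizer_def)
  then have "\<forall>\<^sub>F e in nhds 0. (LINT x|?M. L (x, ?P x, ?V x)) \<le> (LINT x|?M. L (x, ?P x + e * ?p x, ?V x + e * v x))"
    using J(2)[of 0] by (simp add: J(2))
  then have "0 \<le> (LINT x|?M. partial2 L (x, ?P x, ?V x) * ?p x + partial3 L (x, ?P x, ?V x) * v x)"
    by (intro first_variation_nonneg[OF L L', where B = "max B1 B2"])
       (use y \<eta> in \<open>auto simp: max.coboundedI1 max.coboundedI2\<close>)
  then show ?thesis by (simp add: frac_arg_def)
qed

section \<open>The fractional Euler-Lagrange equation\<close>

theorem theorem3p1:
  fixes a b \<alpha> \<beta> :: real
    and L :: "real \<times> real \<times> real \<Rightarrow> real"
    and y :: "real \<Rightarrow> real"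
  assumes "a < b"
    and "\<alpha> \<in> {0<..<1}"
    and "\<beta> \<in> {0<..<1}"
    and "C1_on ({a..b} \<times> UNIV \<times> UNIV) L"
    and "right_RL_integral_exists a b (1 - \<alpha>) (\<lambda>t. partial2 L (frac_arg a b \<alpha> \<beta> y t))"
    and "continuous_on {a..b}
           (right_RL_integral b (1 - \<alpha>) (\<lambda>t. partial2 L (frac_arg a b \<alpha> \<beta> y t)))"
    and "right_RL_deriv_exists a b \<beta> (\<lambda>t. partial3 L (frac_arg a b \<alpha> \<beta> y t))"
    and "continuous_on {a..b}
           (right_RL_deriv a b \<beta> (\<lambda>t. partial3 L (frac_arg a b \<alpha> \<beta> y t)))"
    and "bounded (left_RL_deriv a b \<beta> y ` {a..b})"
    and "local_minimizer a b \<alpha> \<beta> L y"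
  shows "\<forall>x\<in>{a..b}.
           right_RL_integral b (1 - \<alpha>) (\<lambda>t. partial2 L (frac_arg a b \<alpha> \<beta> y t)) x
           + right_RL_deriv a b \<beta> (\<lambda>t. partial3 L (frac_arg a b \<alpha> \<beta> y t)) x = 0"
proof -
  have ab: "a < b" and \<alpha>: "0 < \<alpha>" "\<alpha> < 1" and \<beta>: "0 < \<beta>" "\<beta> < 1" using assms(1-3) by auto
  let ?M = "lebesgue_on {a..b}"
  let ?P = "left_RL_integral a (1 - \<alpha>) y" and ?V = "left_RL_deriv a b \<beta> y"
  define \<phi> where "\<phi> = (\<lambda>t. partial2 L (frac_arg a b \<alpha> \<beta> y t))"
  define \<psi> where "\<psi> = (\<lambda>t. partial3 L (frac_arg a b \<alpha> \<beta> y t))"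
  define A where "A = right_RL_integral b (1 - \<alpha>) \<phi>"
  define D where "D = right_RL_deriv a b \<beta> \<psi>"
  have A_cont: "continuous_on {a..b} A" and D_cont: "continuous_on {a..b} D"
    using assms(6,8) by (simp_all add: A_def D_def \<phi>_def \<psi>_def)
  obtain L' where L: "\<And>z. z \<in> {a..b} \<times> UNIV \<times> UNIV \<Longrightarrow>
        (L has_derivative blinfun_apply (L' z)) (at z within {a..b} \<times> UNIV \<times> UNIV)"
      and L': "continuous_on ({a..b} \<times> UNIV \<times> UNIV) L'"
    using assms(4) unfolding C1_on_def by blast
  interpret R: abel_pair a b "right_kernel \<beta>" "right_kernel (1 - \<beta>)"
    "1 / rl_kernel (1 - \<beta>) (b - a)" "1 / rl_kernel \<beta> (b - a)" "\<lambda>x t. if x < t then 1 else 0"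
    by (rule abel_pair_right[OF \<beta> ab])
  interpret KL: bounded_kernel ?M "left_kernel \<beta>" "1 / rl_kernel (1 - \<beta>) (b - a)"
    by (rule bounded_kernel_left[OF \<beta> ab])
  interpret IL: bounded_kernel ?M "left_kernel (1 - \<alpha>)" "1 / rl_kernel \<alpha> (b - a)"
    using bounded_kernel_left[of "1 - \<alpha>" a b] \<alpha> ab by simp
  have adm: "left_RL_integral_exists a b (1 - \<alpha>) y" "left_RL_deriv_exists a b \<beta> y"
    using assms(10) by (auto simp: local_minimizer_def admissible_def)
  obtain B where y: "?P \<in> borel_measurable ?M" "?V \<in> borel_measurable ?M"
      "\<And>x. x \<in> {a..b} \<Longrightarrow> \<bar>?P x\<bar> \<le> B" "\<And>x. x \<in> {a..b} \<Longrightarrow> \<bar>?V x\<bar> \<le> B"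
    by (rule frac_arg_bounded[OF ab \<alpha> \<beta> adm assms(9)]) (rule that; assumption)
  \<comment> \<open>Both partial derivatives along the minimizer are continuous functions of bounded measurable arguments.\<close>
  have partial: "f \<in> borel_measurable ?M \<and> (\<exists>C. \<forall>x\<in>{a..b}. \<bar>f x\<bar> \<le> C)"
    if f: "\<And>x. x \<in> {a..b} \<Longrightarrow> f x = blinfun_apply (L' (x, ?P x, ?V x)) w" for f w
  proof -
    have c: "continuous_on ({a..b} \<times> UNIV \<times> UNIV) (\<lambda>z. blinfun_apply (L' z) w)"
      by (intro continuous_intros L')
    have "f \<in> borel_measurable ?M"
      by (subst measurable_cong[OF f]) (auto intro: continuous_on_strip_measurable[OF c] y)
    moreover obtain K where "\<And>z. z \<in> {a..b} \<times> {- B..B} \<times> {- B..B} \<Longrightarrow> norm (blinfun_apply (L' z) w) \<le> K"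
      using continuous_on_strip_bounded[OF c] by blast
    then have "\<bar>f x\<bar> \<le> K" if "x \<in> {a..b}" for x
      using y(3,4)[OF that] that f[OF that] by (simp add: abs_le_iff)
    ultimately show ?thesis by blast
  qed
  have \<phi>_eq: "\<phi> x = blinfun_apply (L' (x, ?P x, ?V x)) (0, 1, 0)" if "x \<in> {a..b}" for x
    unfolding \<phi>_def frac_arg_def by (rule partials_eq_derivative(1)[OF L that])
  have \<psi>_eq: "\<psi> x = blinfun_apply (L' (x, ?P x, ?V x)) (0, 0, 1)" if "x \<in> {a..b}" for x
    unfolding \<psi>_def frac_arg_def by (rule partials_eq_derivative(2)[OF L that])
  obtain C\<^sub>\<phi> where \<phi>: "\<phi> \<in> borel_measurable ?M" "\<And>x. x \<in> {a..b} \<Longrightarrow> \<bar>\<phi> x\<bar> \<le> C\<^sub>\<phi>"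
    using partial[OF \<phi>_eq] by blast
  obtain C\<^sub>\<psi> where \<psi>: "\<psi> \<in> borel_measurable ?M" "\<And>x. x \<in> {a..b} \<Longrightarrow> \<bar>\<psi> x\<bar> \<le> C\<^sub>\<psi>"
    using partial[OF \<psi>_eq] by blast
  obtain C\<^sub>A where A: "\<And>x. x \<in> {a..b} \<Longrightarrow> \<bar>A x\<bar> \<le> C\<^sub>A"
    using continuous_on_interval_bounded[OF A_cont] by blast
  obtain C\<^sub>D where D: "\<And>x. x \<in> {a..b} \<Longrightarrow> \<bar>D x\<bar> \<le> C\<^sub>D"
    using continuous_on_interval_bounded[OF D_cont] by blast
  have Am: "A \<in> borel_measurable ?M" and Dm: "D \<in> borel_measurable ?M"
    by (intro continuous_imp_measurable_on_sets_lebesgue A_cont D_cont; simp)+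
  have bounded_integrable: "integrable ?M f"
    if "f \<in> borel_measurable ?M" "\<And>x. x \<in> {a..b} \<Longrightarrow> \<bar>f x\<bar> \<le> C" for f :: "real \<Rightarrow> real" and C
    by (rule R.K.integrable_const_bound[OF _ that(1), where B = C]) (use that(2) in \<open>auto intro: AE_I2\<close>)

  \<comment> \<open>The right fractional integral of order \<open>1 - \<beta>\<close> of \<open>\<psi>\<close> vanishes at \<open>b\<close>, so it is the integral of \<open>D\<close> over \<open>[x,b]\<close>.\<close>
  have \<psi>_inv: "AE x in ?M. \<psi> x = (LINT t|?M. right_kernel \<beta> x t * D t)"
  proof (rule R.abel_inversion[OF bounded_integrable[OF \<psi>] Dm])
    show "AE t in ?M. \<bar>D t\<bar> \<le> \<bar>C\<^sub>D\<bar>" using D by (intro AE_I2) fastforce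
    fix x assume x: "x \<in> {a..b}"
    have "(right_RL_integral b (1 - \<beta>) \<psi> has_vector_derivative - D x) (at x within {a..b})"
      if "x \<in> {a..b}" for x
      using assms(7) that
      by (auto simp: right_RL_deriv_exists_def right_RL_deriv_def vector_derivative_works D_def \<psi>_def)
    from bounded_derivative_integrals(3)[OF this _ x, of C\<^sub>D] D
    have "(LINT t|?M. (if x < t then 1 else 0) * D t) =
        right_RL_integral b (1 - \<beta>) \<psi> x - right_RL_integral b (1 - \<beta>) \<psi> b"
      by simp
    moreover have "right_RL_integral b (1 - \<beta>) \<psi> b = 0"
    proof -
      have "(\<lambda>t. indicator {b..b} t *\<^sub>R ((t - b) powr (1 - \<beta> - 1) * \<psi> t)) = (\<lambda>t. 0)"
        by (auto simp: indicator_def)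
      then show ?thesis by (simp add: right_RL_integral_def set_lebesgue_integral_def)
    qed
    ultimately show "(LINT t|?M. right_kernel (1 - \<beta>) x t * \<psi> t) = (LINT t|?M. (if x < t then 1 else 0) * D t)"
      using right_RL_integral_eq[of "1 - \<beta>" x a b \<psi>] \<beta> x by simp
  qed auto

  define w where "w x = (LINT t|?M. right_kernel \<beta> x t * (A t + D t))" for x
  have ADm: "(\<lambda>t. A t + D t) \<in> borel_measurable ?M" using Am Dm by simp
  have AD: "\<bar>A t + D t\<bar> \<le> C\<^sub>A + C\<^sub>D" if "t \<in> {a..b}" for t
    using A[OF that] D[OF that] by linarith
  have ADi: "integrable ?M (\<lambda>t. A t + D t)" by (rule bounded_integrable[OF ADm AD])
  have wm: "w \<in> borel_measurable ?M"
    unfolding w_def by (rule R.K.measurable_kernel_integral[OF ADm])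
  have wb: "\<bar>w x\<bar> \<le> \<bar>C\<^sub>A + C\<^sub>D\<bar> * (1 / rl_kernel (1 - \<beta>) (b - a))" if "x \<in> {a..b}" for x
    unfolding w_def
    by (rule R.K.abs_kernel_integral_le[OF ADm]) (use AD that in \<open>auto intro!: AE_I2 order_trans[OF AD]\<close>)
  have wi: "integrable ?M w" by (rule bounded_integrable[OF wm wb])

  \<comment> \<open>The first variation in the direction \<open>I\<^sup>\<beta> v\<close>, rewritten by adjointness as a pairing with \<open>v\<close>.\<close>
  have nonneg: "0 \<le> (LINT t|?M. w t * v t)" if v: "continuous_on {a..b} v" for v
  proof -
    define \<eta> where "\<eta> = (\<lambda>x. LINT t|?M. left_kernel \<beta> x t * v t)"
    obtain C where \<eta>: "\<eta> \<in> borel_measurable ?M" "v \<in> borel_measurable ?M"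
        "\<And>x. x \<in> {a..b} \<Longrightarrow> \<bar>\<eta> x\<bar> \<le> C" "\<And>x. x \<in> {a..b} \<Longrightarrow> \<bar>v x\<bar> \<le> C"
        "\<And>x. x \<in> {a..b} \<Longrightarrow> \<bar>left_RL_integral a (1 - \<alpha>) \<eta> x\<bar> \<le> C"
        "left_RL_integral a (1 - \<alpha>) \<eta> \<in> borel_measurable ?M"
      by (rule variation_by_fractional_integral[OF ab \<alpha> \<beta> v \<eta>_def]) (rule that; assumption)
    have prod_int: "integrable ?M (\<lambda>x. f x * g x)"
      if "f \<in> borel_measurable ?M" "\<And>x. x \<in> {a..b} \<Longrightarrow> \<bar>f x\<bar> \<le> E"
        "g \<in> borel_measurable ?M" "\<And>x. x \<in> {a..b} \<Longrightarrow> \<bar>g x\<bar> \<le> F" for f g :: "real \<Rightarrow> real" and E F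
    proof (rule bounded_integrable)
      show "\<bar>f x * g x\<bar> \<le> E * F" if "x \<in> {a..b}" for x
        unfolding abs_mult by (intro mult_mono) (use that \<open>\<And>x. x \<in> {a..b} \<Longrightarrow> \<bar>f x\<bar> \<le> E\<close>
          \<open>\<And>x. x \<in> {a..b} \<Longrightarrow> \<bar>g x\<bar> \<le> F\<close> in \<open>fastforce+\<close>)
    qed (use that in auto)
    have "(LINT x|?M. \<phi> x * left_RL_integral a (1 - \<alpha>) \<eta> x) =
        (LINT x|?M. \<phi> x * (LINT t|?M. left_kernel (1 - \<alpha>) x t * \<eta> t))"
      using \<alpha> by (intro Bochner_Integration.integral_cong) (auto simp: left_RL_integral_eq)
    also have "\<dots> = (LINT t|?M. (LINT x|?M. left_kernel (1 - \<alpha>) x t * \<phi> x) * \<eta> t)"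
      by (rule IL.kernel_integral_adjoint[OF \<eta>(1) _ \<phi>(1)]) (use \<eta> \<phi> in auto)
    also have "\<dots> = (LINT t|?M. A t * \<eta> t)"
      using \<alpha> by (intro Bochner_Integration.integral_cong)
        (auto simp: left_kernel_transpose A_def right_RL_integral_eq)
    also have "\<dots> = (LINT t|?M. (LINT x|?M. left_kernel \<beta> x t * A x) * v t)"
      unfolding \<eta>_def by (rule KL.kernel_integral_adjoint[OF \<eta>(2) _ Am]) (use \<eta> A in auto)
    finally have 1: "(LINT x|?M. \<phi> x * left_RL_integral a (1 - \<alpha>) \<eta> x) =
        (LINT t|?M. (LINT x|?M. right_kernel \<beta> t x * A x) * v t)"
      by (simp add: left_kernel_transpose)
    have KAm: "(\<lambda>t. LINT x|?M. right_kernel \<beta> t x * A x) \<in> borel_measurable ?M"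
      and KDm: "(\<lambda>t. LINT x|?M. right_kernel \<beta> t x * D x) \<in> borel_measurable ?M"
      by (rule R.K.measurable_kernel_integral[OF Am] R.K.measurable_kernel_integral[OF Dm])+
    have 2: "(LINT x|?M. \<psi> x * v x) = (LINT t|?M. (LINT x|?M. right_kernel \<beta> t x * D x) * v t)"
      by (rule integral_cong_AE) (use \<psi>_inv \<psi> \<eta> KDm in \<open>auto elim: eventually_mono\<close>)
    have AEA: "AE t in ?M. \<bar>A t\<bar> \<le> \<bar>C\<^sub>A\<bar>" and AED: "AE t in ?M. \<bar>D t\<bar> \<le> \<bar>C\<^sub>D\<bar>"
      using A D by (intro AE_I2; fastforce)+
    have KAi: "integrable ?M (\<lambda>t. (LINT x|?M. right_kernel \<beta> t x * A x) * v t)"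
      by (rule prod_int[OF KAm _ \<eta>(2) \<eta>(4)]) (use R.K.abs_kernel_integral_le[OF Am AEA] in auto)
    have KDi: "integrable ?M (\<lambda>t. (LINT x|?M. right_kernel \<beta> t x * D x) * v t)"
      by (rule prod_int[OF KDm _ \<eta>(2) \<eta>(4)]) (use R.K.abs_kernel_integral_le[OF Dm AED] in auto)
    have "0 \<le> (LINT x|?M. \<phi> x * left_RL_integral a (1 - \<alpha>) \<eta> x + \<psi> x * v x)"
      using local_minimizer_first_variation[OF ab \<alpha> \<beta> L L' assms(9,10) v \<eta>_def]
      by (simp add: \<phi>_def \<psi>_def)
    also have "\<dots> = (LINT x|?M. \<phi> x * left_RL_integral a (1 - \<alpha>) \<eta> x) + (LINT x|?M. \<psi> x * v x)"
      using Bochner_Integration.integral_add[OF prod_int[OF \<phi> \<eta>(6,5)] prod_int[OF \<psi> \<eta>(2,4)]] by blast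
    also have "\<dots> = (LINT t|?M. (LINT x|?M. right_kernel \<beta> t x * A x) * v t +
        (LINT x|?M. right_kernel \<beta> t x * D x) * v t)"
      unfolding 1 2 by (rule Bochner_Integration.integral_add[OF KAi KDi, symmetric])
    also have "\<dots> = (LINT t|?M. w t * v t)"
    proof (rule Bochner_Integration.integral_cong[OF refl])
      fix t assume t: "t \<in> space ?M"
      show "(LINT x|?M. right_kernel \<beta> t x * A x) * v t + (LINT x|?M. right_kernel \<beta> t x * D x) * v t = w t * v t"
        using R.K.integrable_kernel_mult[OF Am AEA t] R.K.integrable_kernel_mult[OF Dm AED t]
        by (simp add: w_def distrib_left distrib_right)
    qed
    finally show ?thesis .
  qed
  have w0: "AE t in ?M. w t = 0"
  proof (rule AE_zero_if_orthogonal_to_continuous[OF wi])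
    fix v :: "real \<Rightarrow> real" assume "continuous_on UNIV v"
    then have "continuous_on {a..b} v" by (rule continuous_on_subset) simp
    with nonneg[of v] nonneg[of "\<lambda>t. - v t"] show "(LINT t|?M. w t * v t) = 0"
      by (simp add: continuous_on_minus)
  qed
  \<comment> \<open>Applying the complementary fractional integral to \<open>w\<close> recovers the primitive of \<open>A + D\<close>.\<close>
  have AD0: "AE t in ?M. A t + D t = 0"
  proof (rule R.U_determines[OF ADi])
    fix x assume x: "x \<in> {a..b}"
    have "(LINT t|?M. (if x < t then 1 else 0) * (A t + D t)) = (LINT s|?M. right_kernel (1 - \<beta>) x s * w s)"
      unfolding w_def by (rule R.compose_HK[OF ADi x, symmetric])
    also have "\<dots> = 0"
      by (rule integral_eq_zero_AE) (use w0 in eventually_elim, simp)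
    finally show "(LINT t|?M. (if x < t then 1 else 0) * (A t + D t)) = 0" .
  qed
  have "A x + D x = 0" if "x \<in> {a..b}" for x
    by (rule continuous_AE_zero_imp_zero[OF _ ab AD0 that]) (intro continuous_intros A_cont D_cont)
  then show ?thesis by (simp add: A_def D_def \<phi>_def \<psi>_def)
qed

end
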